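(* Let $\lambda_0$ be an $m$-fold eigenvalue ($1\le m<\infty$) of the eigenvalue problem "find $(u,\lambda)\in V\times\mathbb{R}$, $u\neq 0$, with $a(u,v;\mu)=\lambda\, b(u,v;\varepsilon)$ for all $v\in V$" at the parameters $(\mu,\varepsilon)=(\mu_0,\varepsilon_0)\in X\times Y$, with eigenspace $U_0\subset V$ and $b(\cdot,\cdot\,;\varepsilon_0)$-orthonormal eigenbasis $\mathbf{u}_0\in V^m$. Then there exists a unique local (i.e. defined in a neighbourhood of $(\mu_0,\varepsilon_0)$ in $X\times Y$), analytic trajectory $(\mu,\varepsilon)\mapsto(\mathbf{u},\boldsymbol{\lambda})\in V^m\times\mathbb{R}^{m\times m}$ such that $$a(\mathbf{u},\mathbf{v};\mu)=b(\mathbf{u},\mathbf{v};\varepsilon)\cdot\boldsymbol{\lambda}\qquad\text{for all }\mathbf{v}\in V^m$$ (with $\boldsymbol{\lambda}$ not necessarily diagonal) and such that $(\mathbf{u},\boldsymbol{\lambda})=(\mathbf{u}_0,\lambda_0\mathbf{I})$ at $(\mu_0,\varepsilon_0)$. Moreover, $\mathbf{u}-\mathbf{u}_0\in U_0^\perp$ holds, i.e., all elements of $\mathbf{u}-\mathbf{u}_0$ are locally $b(\cdot,\cdot\,;\varepsilon_0)$-orthogonal to $U_0$.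
   Context: $V,H$ are real Hilbert spaces with dense and compact embedding $V\hookrightarrow H$; $X,Y$ are Banach spaces. For a Hilbert space $U$, $B(U)$ is the Banach space of continuous bilinear forms on $U$ with norm $\|a\|_{\mathrm{op}}=\sup_{u,v\ne0}a(u,v)/(\|u\|_U\|v\|_U)$. The forms depend linearly and continuously on the parameters: $a\in\mathcal{L}(X;B(V))$, $b\in\mathcal{L}(Y;B(H))$. For all parameters under consideration (in particular all $(\mu,\varepsilon)$ in a neighbourhood of $(\mu_0,\varepsilon_0)$), $a(\cdot,\cdot\,;\mu)\colon V\times V\to\mathbb{R}$ is a continuous, $V$-elliptic, symmetric bilinear form and $b(\cdot,\cdot\,;\varepsilon)\colon H\times H\to\mathbb{R}$ is a continuous, $H$-elliptic scalar product on $H$. Elements of $V^m$ are row vectors $\mathbf{u}=[[\mathbf{u}]_1,\dots,[\mathbf{u}]_m]$. For $\mathbf{u},\mathbf{v}\in V^m$, $a(\mathbf{u},\mathbf{v};\mu)\in\mathbb{R}^{m\times m}$ is the matrix whose $(i,j)$ entry is $a([\mathbf{u}]_j,[\mathbf{v}]_i;\mu)$; likewise for $b$. $\mathbf{I}$ is the $m\times m$ identity matrix. $U_0^\perp$ is the $b(\cdot,\cdot\,;\varepsilon_0)$-orthogonal complement of $U_0$ in $V$, and $\mathbf{w}\in U_0^\perp$ for $\mathbf{w}\in V^m$ is understood elementwise.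
   Formalization: Uniqueness is asserted only among local analytic trajectories that satisfy u − u0 ∈ U0^⊥; without this normalisation it fails, since (uS, S⁻¹λS) with analytic invertible S, S = I at (μ0, ε0), is another trajectory. *)

theory Defs
  imports "HOL-Analysis.Analysis"
begin

text \<open>
  The space \<open>B(U)\<close> of continuous bilinear forms on \<open>U\<close> is the library's
  \<open>U \<Rightarrow>\<^sub>L U \<Rightarrow>\<^sub>L real\<close>, whose norm is the operator norm of bilinear forms.
\<close>

type_synonym 'u bform = "'u \<Rightarrow>\<^sub>L 'u \<Rightarrow>\<^sub>L real"

definition symmetric_form :: "('u::real_normed_vector) bform \<Rightarrow> bool" where
  "symmetric_form q \<longleftrightarrow>
     (\<forall>u v. blinfun_apply (blinfun_apply q u) v = blinfun_apply (blinfun_apply q v) u)"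

definition elliptic_form :: "('u::real_normed_vector) bform \<Rightarrow> bool" where
  "elliptic_form q \<longleftrightarrow>
     (\<exists>\<alpha>>0. \<forall>u. \<alpha> * (norm u)\<^sup>2 \<le> blinfun_apply (blinfun_apply q u) u)"

text \<open>
  The inclusion of \<open>V\<close> into \<open>H\<close> is an explicit map \<open>\<iota>\<close> between two types.
\<close>

definition dense_compact_embedding ::
    "('v::real_normed_vector \<Rightarrow> 'h::real_normed_vector) \<Rightarrow> bool" where
  "dense_compact_embedding \<iota> \<longleftrightarrow>
     bounded_linear \<iota> \<and> inj \<iota> \<and> closure (range \<iota>) = UNIV \<and>
     (\<forall>S. bounded S \<longrightarrow> compact (closure (\<iota> ` S)))"

definition restrict_form :: "('v \<Rightarrow> 'h) \<Rightarrow> ('h::real_normed_vector) bform \<Rightarrow> 'v \<Rightarrow> 'v \<Rightarrow> real" where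
  "restrict_form \<iota> q u v = blinfun_apply (blinfun_apply q (\<iota> u)) (\<iota> v)"

definition eigenspace ::
    "('v::real_normed_vector \<Rightarrow> 'v \<Rightarrow> real) \<Rightarrow> ('v \<Rightarrow> 'v \<Rightarrow> real) \<Rightarrow> real \<Rightarrow> 'v set" where
  "eigenspace A B l = {u. \<forall>v. A u v = l * B u v}"

definition is_eigenvalue ::
    "('v::real_normed_vector \<Rightarrow> 'v \<Rightarrow> real) \<Rightarrow> ('v \<Rightarrow> 'v \<Rightarrow> real) \<Rightarrow> real \<Rightarrow> bool" where
  "is_eigenvalue A B l \<longleftrightarrow> (\<exists>u. u \<noteq> 0 \<and> (\<forall>v. A u v = l * B u v))"

text \<open>
  Since \<open>dim\<close> is \<open>0\<close> on infinite-dimensional spaces, a positive multiplicity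
  includes that the eigenspace is finite-dimensional.
\<close>

definition is_eigenvalue_of_mult ::
    "nat \<Rightarrow> ('v::real_normed_vector \<Rightarrow> 'v \<Rightarrow> real) \<Rightarrow> ('v \<Rightarrow> 'v \<Rightarrow> real) \<Rightarrow> real \<Rightarrow> bool" where
  "is_eigenvalue_of_mult m A B l \<longleftrightarrow>
     is_eigenvalue A B l \<and> 1 \<le> m \<and> dim (eigenspace A B l) = m"

definition orthonormal_basis_of ::
    "('v::real_normed_vector \<Rightarrow> 'v \<Rightarrow> real) \<Rightarrow> 'v set \<Rightarrow> 'v ^ 'm \<Rightarrow> bool" where
  "orthonormal_basis_of B U w \<longleftrightarrow>
     (\<forall>i j. B (w $ i) (w $ j) = (if i = j then 1 else 0)) \<and>
     span (range (\<lambda>i. w $ i)) = U"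

definition orth_compl :: "('v \<Rightarrow> 'v \<Rightarrow> real) \<Rightarrow> 'v set \<Rightarrow> 'v set" where
  "orth_compl B U = {w. \<forall>u\<in>U. B w u = 0}"

text \<open>Row \<open>i\<close>, column \<open>j\<close> carries the value at \<open>([u]\<^sub>j, [v]\<^sub>i)\<close>, in this order.\<close>

definition form_matrix :: "('v \<Rightarrow> 'v \<Rightarrow> real) \<Rightarrow> 'v ^ 'm \<Rightarrow> 'v ^ 'm \<Rightarrow> real ^ 'm ^ 'm" where
  "form_matrix A u v = (\<chi> i j. A (u $ j) (v $ i))"

text \<open>
  Real analyticity between normed spaces: near \<open>x\<close> the function is a normally convergent
  power series \<open>f (x + h) = (\<Sum>k. T\<^sub>k (h, \<dots>, h))\<close> with continuous \<open>k\<close>-linear maps \<open>T\<^sub>k\<close>.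
  A \<open>k\<close>-linear map is a function on lists, of which only the values at lists of
  length \<open>k\<close> matter.
\<close>

definition multilinear_bounded_by ::
    "nat \<Rightarrow> real \<Rightarrow> ('e::real_normed_vector list \<Rightarrow> 'f::real_normed_vector) \<Rightarrow> bool" where
  "multilinear_bounded_by k C T \<longleftrightarrow>
     (\<forall>xs. length xs = k \<longrightarrow>
        (\<forall>i<k. linear (\<lambda>x. T (xs[i := x]))) \<and>
        norm (T xs) \<le> C * prod_list (map norm xs))"

definition real_analytic_at ::
    "('e::real_normed_vector \<Rightarrow> 'f::real_normed_vector) \<Rightarrow> 'e \<Rightarrow> bool" where
  "real_analytic_at f x \<longleftrightarrow>
     (\<exists>T C r. 0 < r \<and>
        (\<forall>k. multilinear_bounded_by k (C k) (T k)) \<and>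
        summable (\<lambda>k. C k * r ^ k) \<and>
        (\<forall>h. norm h < r \<longrightarrow> (\<lambda>k. T k (replicate k h)) sums f (x + h)))"

definition real_analytic_on ::
    "('e::real_normed_vector \<Rightarrow> 'f::real_normed_vector) \<Rightarrow> 'e set \<Rightarrow> bool" where
  "real_analytic_on f W \<longleftrightarrow> (\<forall>x\<in>W. real_analytic_at f x)"

text \<open>
  An analytic trajectory \<open>(\<mu>, \<epsilon>) \<mapsto> (u, \<lambda>)\<close> on the open neighbourhood \<open>W\<close> of \<open>p0\<close>, starting at
  \<open>s0\<close>; the values outside \<open>W\<close> are irrelevant.
\<close>

definition analytic_trajectory ::
    "('v::real_normed_vector \<Rightarrow> 'h::real_normed_vector) \<Rightarrow>
     ('x::real_normed_vector \<Rightarrow>\<^sub>L 'v bform) \<Rightarrow> ('y::real_normed_vector \<Rightarrow>\<^sub>L 'h bform) \<Rightarrow>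
     'x \<times> 'y \<Rightarrow> ('v ^ 'm::finite) \<times> (real ^ 'm ^ 'm) \<Rightarrow>
     ('x \<times> 'y) set \<Rightarrow> ('x \<times> 'y \<Rightarrow> ('v ^ 'm) \<times> (real ^ 'm ^ 'm)) \<Rightarrow> bool" where
  "analytic_trajectory \<iota> a b p0 s0 W f \<longleftrightarrow>
     open W \<and> p0 \<in> W \<and> real_analytic_on f W \<and> f p0 = s0 \<and>
     (\<forall>\<mu> \<epsilon> u l. (\<mu>, \<epsilon>) \<in> W \<longrightarrow> f (\<mu>, \<epsilon>) = (u, l) \<longrightarrow>
        (\<forall>v. form_matrix (\<lambda>x. blinfun_apply (blinfun_apply (blinfun_apply a \<mu>) x)) u v
              = form_matrix (restrict_form \<iota> (blinfun_apply b \<epsilon>)) u v ** l))"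

text \<open>
  Elementwise \<open>u - u0 \<in> U0\<^sup>\<bottom>\<close> along the trajectory. This condition selects one trajectory: if
  \<open>(u, \<lambda>)\<close> is a trajectory and \<open>S\<close> an analytic family of invertible matrices that is the identity at
  \<open>p0\<close>, then \<open>(u S, S\<^sup>-\<^sup>1 \<lambda> S)\<close> is a trajectory with the same value at \<open>p0\<close>.
\<close>

definition increment_in ::
    "'v set \<Rightarrow> 'v ^ 'm \<Rightarrow> 'p set \<Rightarrow> ('p \<Rightarrow> ('v::real_normed_vector ^ 'm) \<times> (real ^ 'm ^ 'm)) \<Rightarrow> bool" where
  "increment_in N u0 W f \<longleftrightarrow> (\<forall>p\<in>W. \<forall>i. (fst (f p) - u0) $ i \<in> N)"

end

theory Submission
  imports Defs
begin

text \<open>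
  Write \<open>u = u\<^sub>0 + w\<close> with \<open>w\<close> orthogonal to \<open>U\<^sub>0\<close> and \<open>\<lambda> = \<lambda>\<^sub>0 I + \<Lambda>\<close>. The linearisation of the
  eigenvalue equation at the base point is an isomorphism, because the form
  \<open>a - \<lambda>\<^sub>0 b\<close> plus the \<open>b\<close>-orthogonal projection onto \<open>U\<^sub>0\<close> is symmetric, injective and, by
  compactness of the embedding, bounded below. As the forms depend linearly on the parameters, the
  equation becomes a quadratic fixed point problem \<open>z = L h + R z z\<close> in the parameter
  increment \<open>h\<close>. Its formal solution is a power series with a convergent majorant; at
  other points of the neighbourhood one expands around the solution and inverts \<open>1 - D\<close> for a contraction \<open>D\<close>.
\<close>

section \<open>Symmetric forms on Hilbert spaces\<close>

text \<open>A multiple eigenvalue may split under perturbation, and single eigenvectors then need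
  not be analytic in several parameters, while the space spanned by the cluster is. Hence the full
  matrix of eigenvalue increments. It supplies exactly what \<open>a - \<lambda>0 b\<close> lacks at
  the base point: the kernel of this form is \<open>U0\<close>, and its range misses the functionals
  \<open>b(u_k, .)\<close>, which are the coefficients of the matrix entries. Adding the projection
  amounts to solving for the orthogonal increment and a matrix column at once. Analyticity demands a
  power series around every point of a neighbourhood. Instead of rearranging the series at the base
  point, the equation is translated to a solution at \<open>h\<close>, where it is again quadratic;
  uniqueness in a small ball identifies its local solution with the old one. The same ball gives
  uniqueness of the trajectory: continuity at the base point brings the encoded increment of a
  competitor into it.\<close>

lemma riesz_symmetric_elliptic:
  fixes q :: "'v::{real_normed_vector,complete_space} \<Rightarrow> 'v \<Rightarrow> real" and f :: "'v \<Rightarrow> real"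
  assumes q: "bounded_bilinear q" and sym: "\<And>u v. q u v = q v u"
    and \<alpha>: "0 < \<alpha>" "\<And>u. \<alpha> * (norm u)\<^sup>2 \<le> q u u"
    and f: "bounded_linear f"
  obtains u where "\<And>v. q u v = f v"
proof -
  interpret q: bounded_bilinear q by (rule q)
  interpret f: bounded_linear f by (rule f)
  \<comment> \<open>The representing vector is the minimiser of the energy \<open>J\<close>: the
    parallelogram identity makes a minimising sequence Cauchy, and the vanishing first variation is
    the claim.\<close>
  define J where "J v = q v v - 2 * f v" for v
  define I where "I = Inf (range J)"
  obtain F where F: "\<And>x. norm (f x) \<le> norm x * F"
    using f.bounded by blast
  have "- (F\<^sup>2 / \<alpha>) \<le> J v" for v
  proof -
    have "0 \<le> (\<alpha> * norm v - F)\<^sup>2 / \<alpha>"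
      using \<alpha> by simp
    also have "\<dots> = \<alpha> * (norm v)\<^sup>2 - 2 * (norm v * F) + F\<^sup>2 / \<alpha>"
      using \<alpha>(1) by (simp add: power2_eq_square field_simps)
    finally show ?thesis
      unfolding J_def using \<alpha>(2)[of v] F[of v] by auto
  qed
  then have bdd: "bdd_below (range J)"
    by (auto intro!: bdd_belowI)
  have I: "I \<le> J v" for v
    unfolding I_def by (intro cInf_lower bdd) auto
  have par: "\<alpha> * (norm (v - w))\<^sup>2 \<le> 2 * (J v - I) + 2 * (J w - I)" for v w
  proof -
    have "J v + J w - 2 * J ((1/2) *\<^sub>R (v + w)) = q (v - w) (v - w) / 2"
      unfolding J_def
      by (simp add: q.add_left q.add_right q.diff_left q.diff_right q.scaleR_left q.scaleR_right
          f.add f.scaleR sym[of w v] field_simps)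
    with I[of "(1/2) *\<^sub>R (v + w)"] \<alpha>(2)[of "v - w"] show ?thesis by simp
  qed
  have "\<exists>v. J v < I + inverse (real (Suc n))" for n
  proof -
    have "\<exists>y\<in>range J. y < I + inverse (real (Suc n))"
      unfolding I_def by (intro cInf_lessD) (auto simp del: of_nat_Suc)
    then show ?thesis by auto
  qed
  then obtain v where v: "\<And>n. J (v n) < I + inverse (real (Suc n))"
    by metis
  have "Cauchy v"
  proof (rule metric_CauchyI)
    fix e :: real assume "0 < e"
    \<comment> \<open>In \<open>par\<close> each excess over the infimum counts twice, so two
      excesses below this value give a distance below \<open>e\<close>.\<close>
    then have "0 < \<alpha> * e\<^sup>2 / 4" using \<alpha> by simp
    then obtain N where N: "inverse (real (Suc N)) < \<alpha> * e\<^sup>2 / 4"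
      using reals_Archimedean by blast
    have *: "J (v n) - I < \<alpha> * e\<^sup>2 / 4" if "N \<le> n" for n
    proof -
      have "inverse (real (Suc n)) \<le> inverse (real (Suc N))"
        using that by (intro le_imp_inverse_le) auto
      with v[of n] N show ?thesis by linarith
    qed
    have "dist (v m) (v n) < e" if "N \<le> m" "N \<le> n" for m n
    proof -
      have "\<alpha> * (norm (v m - v n))\<^sup>2 < \<alpha> * e\<^sup>2"
        using par[of "v m" "v n"] *[OF that(1)] *[OF that(2)] by (simp add: field_simps)
      then have "(norm (v m - v n))\<^sup>2 < e\<^sup>2" using \<alpha> by simp
      then show ?thesis using \<open>0 < e\<close> by (simp add: dist_norm power2_less_imp_less)
    qed
    then show "\<exists>M. \<forall>m\<ge>M. \<forall>n\<ge>M. dist (v m) (v n) < e" by blast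
  qed
  then obtain u where u: "v \<longlonglongrightarrow> u"
    using Cauchy_convergent convergent_def by blast
  have "(\<lambda>n. J (v n)) \<longlonglongrightarrow> J u"
    unfolding J_def by (intro tendsto_intros q.tendsto f.tendsto u)
  moreover have "(\<lambda>n. I + inverse (real (Suc n))) \<longlonglongrightarrow> I + 0"
    by (intro tendsto_intros LIMSEQ_inverse_real_of_nat)
  ultimately have Ju: "J u \<le> I"
    using LIMSEQ_le[of "\<lambda>n. J (v n)" "J u" "\<lambda>n. I + inverse (real (Suc n))" "I + 0"] v
    by (simp add: less_imp_le)
  have "q u w = f w" for w
  proof -
    define d where "d = q u w - f w"
    have *: "0 \<le> t\<^sup>2 * q w w + 2 * t * d" for t
    proof -
      have "J (u + t *\<^sub>R w) = J u + t\<^sup>2 * q w w + 2 * t * d"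
        unfolding J_def d_def
        by (simp add: q.add_left q.add_right q.scaleR_left q.scaleR_right f.add f.scaleR
            sym[of w u] power2_eq_square algebra_simps)
      with I[of "u + t *\<^sub>R w"] Ju show ?thesis by linarith
    qed
    have "0 \<le> \<alpha> * (norm w)\<^sup>2" using \<alpha>(1) by simp
    then have qw: "0 \<le> q w w" using \<alpha>(2)[of w] by linarith
    \<comment> \<open>The parabola in \<open>t\<close> is tested at \<open>- (d * s)\<close>. The
      summand 1 covers \<open>w = 0\<close> and gives \<open>s * q w w \<le> 1\<close>, so the value
      there is at most \<open>- (d * d * s)\<close>.\<close>
    define s where "s = 1 / (1 + q w w)"
    have s: "0 < s" "s * q w w \<le> 1"
      using qw by (auto simp: s_def)
    have "0 \<le> (- (d * s))\<^sup>2 * q w w + 2 * (- (d * s)) * d"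
      by (rule *)
    also have "\<dots> = d\<^sup>2 * s * (s * q w w - 2)"
      by (simp add: power2_eq_square algebra_simps)
    also have "\<dots> \<le> d\<^sup>2 * s * (1 - 2)"
      using s by (intro mult_left_mono) auto
    finally have "d\<^sup>2 \<le> 0"
      using s(1) by (simp add: mult_le_0_iff)
    then show ?thesis by (simp add: d_def)
  qed
  then show thesis by (rule that)
qed

text \<open>
  With \<open>R\<close> the Riesz map, \<open>(u, v) \<mapsto> \<langle>R T u, R T v\<rangle>\<close> is elliptic, and a representative \<open>u\<close>
  of a functional \<open>f\<close> with respect to it gives \<open>T (R T u) = f\<close> by symmetry of \<open>T\<close>.
\<close>

lemma symmetric_bounded_below_inverse:
  fixes T :: "'v::{real_inner,complete_space} bform"
  assumes sym: "symmetric_form T"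
    and c: "0 < c" "\<And>u. c * norm u \<le> norm (blinfun_apply T u)"
  obtains N :: "('v \<Rightarrow>\<^sub>L real) \<Rightarrow>\<^sub>L 'v"
  where "\<And>f. blinfun_apply T (blinfun_apply N f) = f" "\<And>u. blinfun_apply N (blinfun_apply T u) = u"
proof -
  have "\<exists>u. \<forall>v. u \<bullet> v = blinfun_apply f v" for f :: "'v \<Rightarrow>\<^sub>L real"
    by (rule riesz_symmetric_elliptic[of "(\<bullet>)" 1 "blinfun_apply f"])
      (auto simp: bounded_bilinear_inner inner_commute power2_norm_eq_inner blinfun.bounded_linear_right)
  then obtain R :: "('v \<Rightarrow>\<^sub>L real) \<Rightarrow> 'v" where R: "\<And>f v. R f \<bullet> v = blinfun_apply f v"
    by metis
  have norm_R: "norm (R f) = norm f" for f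
  proof (rule antisym)
    show "norm f \<le> norm (R f)"
      using Cauchy_Schwarz_ineq2[of "R f"] by (intro norm_blinfun_bound) (auto simp: R)
    have "norm (R f) * norm (R f) = blinfun_apply f (R f)"
      by (metis R power2_eq_square power2_norm_eq_inner)
    also have "\<dots> \<le> norm f * norm (R f)"
      using norm_blinfun[of f "R f"] by simp
    finally show "norm (R f) \<le> norm f"
      by (metis mult_right_le_imp_le norm_ge_zero norm_le_zero_iff order_le_less zero_less_norm_iff)
  qed
  have lin_R: "bounded_linear R"
    by (rule bounded_linear_intro[of _ 1])
      (auto simp: norm_R vector_eq_rdot[symmetric] inner_add_left R blinfun.add_left blinfun.scaleR_left)
  have RT: "bounded_linear (\<lambda>u. R (blinfun_apply T u))"
    by (rule bounded_linear_compose[OF lin_R blinfun.bounded_linear_right])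
  have surj: "\<exists>u. blinfun_apply T u = f" for f
  proof -
    obtain u where u: "\<And>v. R (blinfun_apply T u) \<bullet> R (blinfun_apply T v) = blinfun_apply f v"
    proof (rule riesz_symmetric_elliptic[of "\<lambda>u v. R (blinfun_apply T u) \<bullet> R (blinfun_apply T v)" "c\<^sup>2" "blinfun_apply f"])
      show "bounded_bilinear (\<lambda>u v. R (blinfun_apply T u) \<bullet> R (blinfun_apply T v))"
        by (rule bounded_bilinear.comp[OF bounded_bilinear_inner RT RT])
      show "c\<^sup>2 * (norm u)\<^sup>2 \<le> R (blinfun_apply T u) \<bullet> R (blinfun_apply T u)" for u
        using c(2)[of u] c(1)
        by (simp add: power2_norm_eq_inner[symmetric] norm_R power_mult_distrib[symmetric] power_mono)
    qed (use c in \<open>auto simp: inner_commute blinfun.bounded_linear_right\<close>)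
    have "blinfun_apply T (R (blinfun_apply T u)) = f"
    proof (rule blinfun_eqI)
      fix v
      have "blinfun_apply (blinfun_apply T (R (blinfun_apply T u))) v
          = blinfun_apply (blinfun_apply T v) (R (blinfun_apply T u))"
        using sym by (simp add: symmetric_form_def)
      also have "\<dots> = blinfun_apply f v"
        using u[of v] by (simp add: R[symmetric] inner_commute)
      finally show "blinfun_apply (blinfun_apply T (R (blinfun_apply T u))) v = blinfun_apply f v" .
    qed
    then show ?thesis ..
  qed
  have inj: "u = v" if "blinfun_apply T u = blinfun_apply T v" for u v
  proof -
    have "c * norm (u - v) \<le> 0"
      using c(2)[of "u - v"] that by (simp add: blinfun.diff_right)
    then show ?thesis using c(1) by (simp add: mult_le_0_iff)
  qed
  obtain N where N: "\<And>f. blinfun_apply T (N f) = f"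
    using surj by metis
  have "bounded_linear N"
  proof (rule bounded_linear_intro[of _ "1 / c"])
    show "norm (N f) \<le> norm f * (1 / c)" for f
      using c(2)[of "N f"] c(1) by (simp add: N field_simps)
  qed (auto intro!: inj simp: N blinfun.add_right blinfun.scaleR_right)
  then have "blinfun_apply (Blinfun N) = N"
    by (rule bounded_linear_Blinfun_apply)
  moreover have "N (blinfun_apply T u) = u" for u
    by (rule inj) (rule N)
  ultimately show thesis
    using that[of "Blinfun N"] N by simp
qed

section \<open>Analytic maps\<close>

lemma multilinear_bounded_by_norm:
  assumes "multilinear_bounded_by k C T"
  shows "norm (T (replicate k h)) \<le> \<bar>C\<bar> * norm h ^ k"
proof -
  have "norm (T (replicate k h)) \<le> C * norm h ^ k"
    using assms[unfolded multilinear_bounded_by_def, rule_format, of "replicate k h"] by simp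
  also have "\<dots> \<le> \<bar>C\<bar> * norm h ^ k"
    by (intro mult_right_mono) auto
  finally show ?thesis .
qed

text \<open>Every term after the zeroth carries a factor \<open>norm h\<close>, so the increment is
  at most a constant times \<open>norm h\<close>. This keeps solutions inside small balls and brings
  a competing trajectory close to the initial value.\<close>

lemma real_analytic_at_isCont:
  fixes f :: "'e::real_normed_vector \<Rightarrow> 'f::real_normed_vector"
  assumes "real_analytic_at f x"
  shows "isCont f x"
proof -
  obtain T C r where r: "0 < r" and T: "\<And>k. multilinear_bounded_by k (C k) (T k)"
    and C: "summable (\<lambda>k. C k * r ^ k)"
    and f: "\<And>h. norm h < r \<Longrightarrow> (\<lambda>k. T k (replicate k h)) sums f (x + h)"
    using assms unfolding real_analytic_at_def by blast
  \<comment> \<open>The signs of the \<open>C k\<close> are not prescribed, so absolute convergence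
    is taken strictly inside \<open>r\<close>.\<close>
  define \<rho> where "\<rho> = r / 2"
  have \<rho>: "0 < \<rho>" "\<rho> < r" using r by (auto simp: \<rho>_def)
  have sm: "summable (\<lambda>k. \<bar>C k\<bar> * \<rho> ^ k)"
    using powser_insidea[OF C, of \<rho>] \<rho> by (simp add: abs_mult power_abs)
  define S where "S = (\<Sum>k. \<bar>C k\<bar> * \<rho> ^ k)"
  have T00: "T 0 [] = f x"
  proof -
    have "T k (replicate k 0) = 0" if "k \<noteq> 0" for k
      using multilinear_bounded_by_norm[OF T[of k], of 0] that by (simp add: power_0_left)
    then have "(\<lambda>k. T k (replicate k 0)) sums T 0 (replicate 0 0)"
      by (intro sums_finite[of "{0}", simplified]) auto
    then show ?thesis using f[of 0] r sums_unique2 by fastforce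
  qed
  have bound: "norm (f (x + h) - f x) \<le> norm h * (S / \<rho>)" if h: "norm h \<le> \<rho>" for h
  proof (rule LIMSEQ_le_const2)
    show "(\<lambda>n. norm ((\<Sum>k<n. T k (replicate k h)) - f x)) \<longlonglongrightarrow> norm (f (x + h) - f x)"
      using f[of h] h \<rho> by (intro tendsto_intros) (auto simp: sums_def)
    show "\<exists>N. \<forall>n\<ge>N. norm ((\<Sum>k<n. T k (replicate k h)) - f x) \<le> norm h * (S / \<rho>)"
    proof (intro exI allI impI)
      fix n :: nat assume "1 \<le> n"
      then obtain m where m: "n = Suc m" by (cases n) auto
      have "norm (T (Suc k) (replicate (Suc k) h)) \<le> norm h / \<rho> * (\<bar>C (Suc k)\<bar> * \<rho> ^ Suc k)" for k
      proof -
        have "norm (T (Suc k) (replicate (Suc k) h)) \<le> \<bar>C (Suc k)\<bar> * norm h ^ Suc k"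
          by (rule multilinear_bounded_by_norm[OF T])
        also have "norm h ^ Suc k \<le> norm h * \<rho> ^ k"
          using h by (simp add: mult_left_mono power_mono)
        then have "\<bar>C (Suc k)\<bar> * norm h ^ Suc k \<le> \<bar>C (Suc k)\<bar> * (norm h * \<rho> ^ k)"
          by (intro mult_left_mono) auto
        also have "\<dots> = norm h / \<rho> * (\<bar>C (Suc k)\<bar> * \<rho> ^ Suc k)"
          using \<rho> by simp
        finally show ?thesis .
      qed
      then have "norm (\<Sum>k<m. T (Suc k) (replicate (Suc k) h))
          \<le> (\<Sum>k<m. norm h / \<rho> * (\<bar>C (Suc k)\<bar> * \<rho> ^ Suc k))"
        by (intro sum_norm_le) auto
      also have "\<dots> = norm h / \<rho> * (\<Sum>k<m. \<bar>C (Suc k)\<bar> * \<rho> ^ Suc k)"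
        by (simp add: sum_distrib_left)
      also have "(\<Sum>k<m. \<bar>C (Suc k)\<bar> * \<rho> ^ Suc k) \<le> (\<Sum>k<n. \<bar>C k\<bar> * \<rho> ^ k)"
        unfolding m by (subst sum.lessThan_Suc_shift) simp
      also have "\<dots> \<le> S"
        unfolding S_def using \<rho> by (intro sum_le_suminf[OF sm]) auto
      finally show "norm ((\<Sum>k<n. T k (replicate k h)) - f x) \<le> norm h * (S / \<rho>)"
        using \<rho> unfolding m by (subst sum.lessThan_Suc_shift) (simp add: T00 mult_left_mono divide_right_mono)
    qed
  qed
  have "((\<lambda>h. f (x + h) - f x) \<longlongrightarrow> 0) (at 0)"
  proof (rule Lim_null_comparison)
    show "\<forall>\<^sub>F h in at 0. norm (f (x + h) - f x) \<le> norm h * (S / \<rho>)"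
      unfolding eventually_at using \<rho> bound by (auto intro!: exI[of _ \<rho>] simp: dist_norm)
    show "((\<lambda>h::'e. norm h * (S / \<rho>)) \<longlongrightarrow> 0) (at 0)"
      using \<rho> by (auto intro!: tendsto_eq_intros)
  qed
  then show ?thesis
    by (simp add: isCont_iff LIM_zero_iff)
qed

text \<open>The zeroth coefficient absorbs \<open>c\<close>, and \<open>A\<close> acts on every
  coefficient. Equality near the point suffices, so a series found elsewhere can serve after
  translation: for the solution around a nonzero increment, and for the decoded trajectory.\<close>

lemma real_analytic_at_affine_compose:
  fixes g :: "'e::real_normed_vector \<Rightarrow> 'f::real_normed_vector" and A :: "'f \<Rightarrow> 'g::real_normed_vector"
  assumes g: "real_analytic_at g x" and A: "bounded_linear A"
    and f: "\<forall>\<^sub>F h in nhds 0. f (y + h) = c + A (g (x + h))"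
  shows "real_analytic_at f y"
proof -
  interpret A: bounded_linear A by (rule A)
  obtain T C r where r: "0 < r" and T: "\<And>k. multilinear_bounded_by k (C k) (T k)"
    and C: "summable (\<lambda>k. C k * r ^ k)"
    and g: "\<And>h. norm h < r \<Longrightarrow> (\<lambda>k. T k (replicate k h)) sums g (x + h)"
    using g unfolding real_analytic_at_def by blast
  obtain K where K: "0 \<le> K" "\<And>x. norm (A x) \<le> norm x * K"
    using A.nonneg_bounded by blast
  obtain \<delta> where \<delta>: "0 < \<delta>" "\<And>h. norm h < \<delta> \<Longrightarrow> f (y + h) = c + A (g (x + h))"
    using f unfolding eventually_nhds_metric by (auto simp: dist_norm)
  define \<rho> where "\<rho> = min \<delta> (r / 2)"
  have \<rho>: "0 < \<rho>" "\<rho> < r" "\<rho> \<le> \<delta>" using r \<delta>(1) by (auto simp: \<rho>_def)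
  define T' where "T' k xs = (if k = 0 then c else 0) + A (T k xs)" for k xs
  define C' where "C' k = (if k = 0 then norm c else 0) + K * C k" for k
  have 1: "multilinear_bounded_by k (C' k) (T' k)" for k
    unfolding multilinear_bounded_by_def
  proof (intro allI impI conjI)
    fix xs :: "'e list" and i assume "length xs = k" "i < k"
    then have "linear (\<lambda>x. T k (xs[i := x]))"
      using T[of k] by (simp add: multilinear_bounded_by_def)
    then show "linear (\<lambda>x. T' k (xs[i := x]))"
      using \<open>i < k\<close> linear_compose[OF _ A.linear] by (simp add: T'_def o_def)
  next
    fix xs :: "'e list" assume "length xs = k"
    then have "norm (T k xs) \<le> C k * prod_list (map norm xs)"
      using T[of k] by (simp add: multilinear_bounded_by_def)
    then have "norm (A (T k xs)) \<le> K * (C k * prod_list (map norm xs))"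
      using K(2)[of "T k xs"] mult_left_mono[OF _ K(1)] by (fastforce simp: mult.commute)
    moreover have "norm (if k = 0 then c else 0) = (if k = 0 then norm c else 0) * prod_list (map norm xs)"
      using \<open>length xs = k\<close> by auto
    ultimately show "norm (T' k xs) \<le> C' k * prod_list (map norm xs)"
      unfolding T'_def C'_def ring_distribs
      by (intro norm_triangle_le) (auto simp: mult.assoc)
  qed
  have "summable (\<lambda>k. C k * \<rho> ^ k)"
    using powser_inside[OF C, of \<rho>] \<rho> by simp
  then have "summable (\<lambda>k. K * (C k * \<rho> ^ k))"
    by (rule summable_mult)
  moreover have "summable (\<lambda>k. (if k = 0 then norm c else 0) * \<rho> ^ k)"
    by (rule summable_finite[of "{0}"]) auto
  ultimately have 2: "summable (\<lambda>k. C' k * \<rho> ^ k)"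
    unfolding C'_def ring_distribs mult.assoc by (rule summable_add[rotated])
  have 3: "(\<lambda>k. T' k (replicate k h)) sums f (y + h)" if "norm h < \<rho>" for h
  proof -
    have "(\<lambda>k. A (T k (replicate k h))) sums A (g (x + h))"
      using g[of h] \<rho> that by (intro A.sums) auto
    moreover have "(\<lambda>k. if k = 0 then c else 0) sums c"
      using sums_single[of 0 "\<lambda>_. c"] by simp
    ultimately show ?thesis
      unfolding T'_def using \<delta>(2)[of h] \<rho> that by (auto intro: sums_add)
  qed
  show ?thesis
    unfolding real_analytic_at_def using 1 2 3 \<rho>(1) by blast
qed

section \<open>Quadratic equations\<close>

text \<open>
  The homogeneous parts of the solution of \<open>z = L h + R z z\<close>: each is obtained by
  splitting the list of arguments in all possible ways.
\<close>

function quadratic_series ::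
  "('e \<Rightarrow> 'z) \<Rightarrow> ('z \<Rightarrow> 'z \<Rightarrow> 'z) \<Rightarrow> 'e list \<Rightarrow> 'z::real_normed_vector" where
  "quadratic_series L R xs =
     (if length xs = 1 then L (hd xs)
      else \<Sum>i\<in>{1..<length xs}. R (quadratic_series L R (take i xs)) (quadratic_series L R (drop i xs)))"
  by auto
termination by (relation "Wellfounded.measure (\<lambda>(L, R, xs). length xs)") auto

text \<open>Scaled Catalan numbers: the coefficients, in powers of \<open>r\<close>, of the small
  root of \<open>s = l * r + K * s * s\<close>. For positive \<open>K * l\<close> the radius of
  convergence is \<open>1 / (4 * K * l)\<close>. The value at 0 is an empty sum.\<close>

fun quadratic_majorant :: "real \<Rightarrow> real \<Rightarrow> nat \<Rightarrow> real" where
  "quadratic_majorant l K n =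
     (if n = 1 then l
      else \<Sum>i\<in>{1..<n}. K * (quadratic_majorant l K i * quadratic_majorant l K (n - i)))"

declare quadratic_series.simps [simp del] quadratic_majorant.simps [simp del]

lemma quadratic_majorant_nonneg:
  assumes "0 \<le> l" "0 \<le> K"
  shows "0 \<le> quadratic_majorant l K n"
proof (induction n rule: less_induct)
  case (less n)
  then show ?case
    using assms by (subst quadratic_majorant.simps) (auto intro!: sum_nonneg mult_nonneg_nonneg)
qed

text \<open>The product of the norms over a list factors along each split, so the majorant obeys the
  same recursion with \<open>K\<close> in place of \<open>R\<close>.\<close>

lemma norm_quadratic_series:
  assumes L: "\<And>x. norm (L x) \<le> l * norm x" and R: "\<And>x y. norm (R x y) \<le> K * (norm x * norm y)"
    and l: "0 \<le> l" and K: "0 \<le> K"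
  shows "norm (quadratic_series L R xs) \<le> quadratic_majorant l K (length xs) * prod_list (map norm xs)"
proof (induction xs rule: length_induct)
  case (1 xs)
  show ?case
  proof (cases "length xs = 1")
    case True
    then obtain x where "xs = [x]" by (auto simp: length_Suc_conv)
    then show ?thesis using L by (simp add: quadratic_series.simps quadratic_majorant.simps)
  next
    case False
    let ?t = "quadratic_series L R" and ?c = "quadratic_majorant l K" and ?p = "\<lambda>xs. prod_list (map norm xs)"
    have "norm (R (?t (take i xs)) (?t (drop i xs)))
        \<le> K * (?c i * ?c (length xs - i)) * ?p xs" if i: "i \<in> {1..<length xs}" for i
    proof -
      have "norm (?t (take i xs)) \<le> ?c i * ?p (take i xs)"
        using 1[rule_format, of "take i xs"] i by (simp add: min_def)
      moreover have "norm (?t (drop i xs)) \<le> ?c (length xs - i) * ?p (drop i xs)"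
        using 1[rule_format, of "drop i xs"] i diff_less[of i "length xs"] by auto
      ultimately have "norm (?t (take i xs)) * norm (?t (drop i xs))
          \<le> (?c i * ?p (take i xs)) * (?c (length xs - i) * ?p (drop i xs))"
        by (meson mult_mono norm_ge_zero order_trans)
      also have "\<dots> = ?c i * ?c (length xs - i) * (?p (take i xs) * ?p (drop i xs))"
        by simp
      also have "?p (take i xs) * ?p (drop i xs) = ?p xs"
        by (metis append_take_drop_id map_append prod_list.append)
      finally show ?thesis
        using R[of "?t (take i xs)" "?t (drop i xs)"] mult_left_mono[OF _ K]
        by (fastforce simp: mult.assoc)
    qed
    then have "norm (\<Sum>i\<in>{1..<length xs}. R (?t (take i xs)) (?t (drop i xs)))
        \<le> (\<Sum>i\<in>{1..<length xs}. K * (?c i * ?c (length xs - i)) * ?p xs)"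
      by (rule sum_norm_le)
    with False show ?thesis
      by (simp add: quadratic_series.simps[of L R xs] quadratic_majorant.simps[of l K "length xs"] sum_distrib_right)
  qed
qed

text \<open>A given position lies in exactly one piece of each split, and \<open>R\<close> is linear
  in that piece.\<close>

lemma linear_quadratic_series:
  assumes L: "linear L" and R: "bounded_bilinear R" and "i < length xs"
  shows "linear (\<lambda>x. quadratic_series L R (xs[i := x]))"
  using \<open>i < length xs\<close>
proof (induction xs arbitrary: i rule: length_induct)
  case (1 xs i)
  interpret R: bounded_bilinear R by (rule R)
  show ?case
  proof (cases "length xs = 1")
    case True
    then obtain x where "xs = [x]" by (auto simp: length_Suc_conv)
    then show ?thesis using L 1(2) by (simp add: quadratic_series.simps)
  next
    case False
    let ?t = "quadratic_series L R"
    have "linear (\<lambda>x. R (?t (take j (xs[i := x]))) (?t (drop j (xs[i := x]))))"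
      if j: "j \<in> {1..<length xs}" for j
    proof (cases "i < j")
      case True
      then have "linear (\<lambda>x. ?t ((take j xs)[i := x]))"
        using 1(1)[rule_format, of "take j xs" i] 1(2) j by simp
      then have "linear (\<lambda>x. R (?t ((take j xs)[i := x])) (?t (drop j xs)))"
        using linear_compose[OF _ bounded_linear.linear[OF R.bounded_linear_left]] by (simp add: o_def)
      then show ?thesis using True by (simp add: take_update_swap drop_update_cancel)
    next
      case False
      then have "linear (\<lambda>x. ?t ((drop j xs)[i - j := x]))"
        using 1(1)[rule_format, of "drop j xs" "i - j"] 1(2) j by simp
      then have "linear (\<lambda>x. R (?t (take j xs)) (?t ((drop j xs)[i - j := x])))"
        using linear_compose[OF _ bounded_linear.linear[OF R.bounded_linear_right]] by (simp add: o_def)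
      then show ?thesis using False by (simp add: drop_update_swap take_update_cancel)
    qed
    then have "linear (\<lambda>x. \<Sum>j\<in>{1..<length xs}. R (?t (take j (xs[i := x]))) (?t (drop j (xs[i := x]))))"
      by (intro linear_compose_sum) auto
    with False show ?thesis by (simp add: quadratic_series.simps[of L R "xs[i := _]"])
  qed
qed

text \<open>
  If \<open>s \<ge> l r + K s\<^sup>2\<close>, then \<open>s\<close> bounds every partial sum of the majorant series at \<open>r\<close>, by
  the quadratic recursion; \<open>s = 2 l r\<close> satisfies the inequality.
\<close>

lemma summable_quadratic_majorant:
  assumes l: "0 \<le> l" and K: "0 \<le> K" and r: "0 \<le> r" "4 * K * l * r \<le> 1"
  shows "summable (\<lambda>n. quadratic_majorant l K n * r ^ n)"
proof -
  define a where "a n = quadratic_majorant l K n * r ^ n" for n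
  have a0: "0 \<le> a n" for n
    unfolding a_def using r by (simp add: quadratic_majorant_nonneg[OF l K])
  have rec: "a n = (if n = 1 then l * r else 0) + (\<Sum>i\<in>{1..<n}. K * (a i * a (n - i)))" for n
  proof (cases "n = 1")
    case True
    then show ?thesis by (simp add: a_def quadratic_majorant.simps[of l K "Suc 0"])
  next
    case False
    have "K * (quadratic_majorant l K i * quadratic_majorant l K (n - i)) * r ^ n = K * (a i * a (n - i))"
      if "i \<in> {1..<n}" for i
    proof -
      have "r ^ n = r ^ i * r ^ (n - i)"
        using that by (simp add: power_add[symmetric])
      then show ?thesis by (simp add: a_def)
    qed
    then have "(\<Sum>i\<in>{1..<n}. K * (quadratic_majorant l K i * quadratic_majorant l K (n - i)) * r ^ n)
        = (\<Sum>i\<in>{1..<n}. K * (a i * a (n - i)))"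
      by (rule sum.cong[OF refl])
    then show ?thesis
      using False by (simp add: a_def[of n] quadratic_majorant.simps[of l K n] sum_distrib_right)
  qed
  have partial: "(\<Sum>n<N. a n) \<le> 2 * l * r" for N
  proof (induction N)
    case 0
    then show ?case using l r by simp
  next
    case (Suc N)
    define S where "S = (\<Sum>n<N. a n)"
    have S: "0 \<le> S" "S \<le> 2 * l * r"
      using Suc a0 by (auto simp: S_def intro: sum_nonneg)
    \<comment> \<open>Both parts \<open>i\<close> and \<open>n - i\<close> of a split of
      \<open>n \<le> N\<close> are positive, hence below \<open>N\<close>. The pairs therefore lie
      in a square, over which the sum is \<open>K\<close> times the square of the previous partial
      sum.\<close>
    have "(\<Sum>n<Suc N. \<Sum>i\<in>{1..<n}. K * (a i * a (n - i)))
        = (\<Sum>(n, i)\<in>(SIGMA n:{..<Suc N}. {1..<n}). K * (a i * a (n - i)))"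
      by (rule sum.Sigma) auto
    also have "\<dots> = (\<Sum>(i, j)\<in>(\<lambda>(n, i). (i, n - i)) ` (SIGMA n:{..<Suc N}. {1..<n}). K * (a i * a j))"
      by (subst sum.reindex) (auto simp: inj_on_def split_def)
    also have "\<dots> \<le> (\<Sum>(i, j)\<in>{..<N} \<times> {..<N}. K * (a i * a j))"
      using K a0 by (intro sum_mono2) auto
    also have "\<dots> = K * S\<^sup>2"
      unfolding sum.cartesian_product[symmetric] sum_distrib_left[symmetric]
      unfolding S_def power2_eq_square sum_product by (simp only: sum_distrib_left)
    also have "\<dots> \<le> K * (2 * l * r)\<^sup>2"
      using S K by (intro mult_left_mono power_mono) auto
    also have "\<dots> = (4 * K * l * r) * (l * r)"
      by (simp add: power2_eq_square)
    also have "\<dots> \<le> 1 * (l * r)"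
      using r l by (intro mult_right_mono) auto
    finally have "(\<Sum>n<Suc N. \<Sum>i\<in>{1..<n}. K * (a i * a (n - i))) \<le> l * r" by simp
    moreover have "(\<Sum>n<Suc N. if n = 1 then l * r else 0) \<le> l * r"
      using l r by (subst sum.delta) auto
    moreover have "(\<Sum>n<Suc N. a n) = (\<Sum>n<Suc N. if n = 1 then l * r else 0)
        + (\<Sum>n<Suc N. \<Sum>i\<in>{1..<n}. K * (a i * a (n - i)))"
      unfolding sum.distrib[symmetric] by (rule sum.cong[OF refl rec])
    ultimately show ?case by linarith
  qed
  have "summable a"
    by (rule bounded_imp_summable[where B = "2 * l * r"])
      (auto simp: a0 lessThan_Suc_atMost[symmetric] partial simp del: sum.lessThan_Suc)
  then show ?thesis by (simp add: a_def[abs_def])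
qed

text \<open>Sums over squares converge by continuity of \<open>R\<close>. They differ from the
  triangular sums of the Cauchy product by a sum over \<open>D N\<close>, dominated by the same
  difference for the series of norms, which tends to 0 by the scalar theorem.\<close>

lemma Cauchy_product_sums_bilinear:
  fixes R :: "'a::banach \<Rightarrow> 'b::banach \<Rightarrow> 'c::real_normed_vector"
  assumes R: "bounded_bilinear R"
    and f: "summable (\<lambda>n. norm (f n))" and g: "summable (\<lambda>n. norm (g n))"
  shows "(\<lambda>n. \<Sum>i\<le>n. R (f i) (g (n - i))) sums R (\<Sum>n. f n) (\<Sum>n. g n)"
proof -
  interpret R: bounded_bilinear R by (rule R)
  obtain K where K: "0 \<le> K" "\<And>x y. norm (R x y) \<le> norm x * norm y * K"
    using R.nonneg_bounded by blast
  define D where "D N = {..<N} \<times> {..<N} - {(i, j). i + j < N}" for N :: nat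
  have split: "(\<Sum>i<N. \<Sum>j<N. F i j) - (\<Sum>n<N. \<Sum>i\<le>n. F i (n - i)) = (\<Sum>(i, j)\<in>D N. F i j)"
    for N and F :: "nat \<Rightarrow> nat \<Rightarrow> 'd::ab_group_add"
  proof -
    have "{(i, j). i + j < N} \<subseteq> {..<N} \<times> {..<N}" by auto
    then show ?thesis
      unfolding D_def sum.triangle_reindex[symmetric] sum.cartesian_product
      by (subst sum_diff) auto
  qed
  have lim: "(\<lambda>N. R (\<Sum>i<N. f i) (\<Sum>j<N. g j)) \<longlonglongrightarrow> R (\<Sum>n. f n) (\<Sum>n. g n)"
    by (intro R.tendsto summable_LIMSEQ) (rule summable_norm_cancel[OF f] summable_norm_cancel[OF g])+
  define E where "E N = (\<Sum>i<N. \<Sum>j<N. norm (f i) * norm (g j))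
      - (\<Sum>n<N. \<Sum>i\<le>n. norm (f i) * norm (g (n - i)))" for N
  have "(\<lambda>N. (\<Sum>i<N. norm (f i)) * (\<Sum>j<N. norm (g j))) \<longlonglongrightarrow> (\<Sum>n. norm (f n)) * (\<Sum>n. norm (g n))"
    using f g by (intro tendsto_mult summable_LIMSEQ)
  moreover have "(\<lambda>N. \<Sum>n<N. \<Sum>i\<le>n. norm (f i) * norm (g (n - i))) \<longlonglongrightarrow> (\<Sum>n. norm (f n)) * (\<Sum>n. norm (g n))"
    using Cauchy_product_sums[of "\<lambda>n. norm (f n)" "\<lambda>n. norm (g n)"] f g by (simp add: sums_def)
  ultimately have "E \<longlonglongrightarrow> 0"
    unfolding E_def sum_product[symmetric] using tendsto_diff by fastforce
  then have "(\<lambda>N. E N * K) \<longlonglongrightarrow> 0"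
    by (rule tendsto_mult_left_zero)
  then have diff: "(\<lambda>N. (\<Sum>i<N. \<Sum>j<N. R (f i) (g j)) - (\<Sum>n<N. \<Sum>i\<le>n. R (f i) (g (n - i)))) \<longlonglongrightarrow> 0"
  proof (rule Lim_null_comparison[rotated], intro always_eventually allI)
    fix N
    have "norm (\<Sum>(i, j)\<in>D N. R (f i) (g j)) \<le> (\<Sum>(i, j)\<in>D N. norm (f i) * norm (g j) * K)"
      using K(2) by (intro sum_norm_le) auto
    also have "\<dots> = E N * K"
      unfolding E_def split[of "\<lambda>i j. norm (f i) * norm (g j)"] by (simp add: sum_distrib_right split_def)
    finally show "norm ((\<Sum>i<N. \<Sum>j<N. R (f i) (g j)) - (\<Sum>n<N. \<Sum>i\<le>n. R (f i) (g (n - i)))) \<le> E N * K"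
      unfolding split[of "\<lambda>i j. R (f i) (g j)"] .
  qed
  have "R (\<Sum>i<N. f i) (\<Sum>j<N. g j) = (\<Sum>i<N. \<Sum>j<N. R (f i) (g j))" for N
    by (subst R.sum_left) (simp only: R.sum_right)
  with tendsto_diff[OF lim diff] show ?thesis
    by (simp add: sums_def)
qed

lemma quadratic_equation_local_solution:
  fixes L :: "'e::real_normed_vector \<Rightarrow> 'z::banach"
  assumes L: "bounded_linear L" and R: "bounded_bilinear R"
  obtains z r where "0 < r" "real_analytic_at z 0" "z 0 = 0"
    "\<And>h. norm h < r \<Longrightarrow> z h = L h + R (z h) (z h)"
proof -
  interpret L: bounded_linear L by (rule L)
  interpret R: bounded_bilinear R by (rule R)
  obtain l where l: "0 \<le> l" "\<And>x. norm (L x) \<le> l * norm x"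
    using L.nonneg_bounded by (auto simp: mult.commute)
  obtain K where K: "0 \<le> K" "\<And>x y. norm (R x y) \<le> K * (norm x * norm y)"
    using R.nonneg_bounded by (auto simp: mult.commute)
  \<comment> \<open>The summand 1 keeps the radius defined when \<open>K * l\<close> is 0.\<close>
  define r where "r = 1 / (4 * K * l + 1)"
  have Kl: "0 \<le> 4 * K * l" using K l by simp
  then have r: "0 < r" "4 * K * l * r \<le> 1"
    by (auto simp: r_def field_simps add_nonneg_pos)
  define c where "c = quadratic_majorant l K"
  define T where "T = quadratic_series L R"
  have c: "summable (\<lambda>n. c n * r ^ n)"
    unfolding c_def using r by (intro summable_quadratic_majorant l K) auto
  have c0: "0 \<le> c n" for n
    unfolding c_def by (rule quadratic_majorant_nonneg[OF l(1) K(1)])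
  have T: "multilinear_bounded_by k (c k) T" for k
    unfolding multilinear_bounded_by_def T_def c_def
    using linear_quadratic_series[OF L.linear R] norm_quadratic_series[OF l(2) K(2) l(1) K(1)] by auto
  define t where "t h n = T (replicate n h)" for h n
  define z where "z h = (\<Sum>n. t h n)" for h
  have norm_t: "norm (t h n) \<le> c n * norm h ^ n" for h n
    using multilinear_bounded_by_norm[OF T[of n]] c0[of n] by (simp add: t_def)
  have sm: "summable (\<lambda>n. norm (t h n))" if "norm h < r" for h
  proof (rule summable_comparison_test'[OF c, of 0])
    fix n
    have "c n * norm h ^ n \<le> c n * r ^ n"
      using c0 that by (intro mult_left_mono power_mono) auto
    then show "norm (norm (t h n)) \<le> c n * r ^ n"
      using norm_t[of h n] by simp
  qed
  \<comment> \<open>The empty list has value 0, so the splits into nonempty pieces can be completed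
    to the full Cauchy product over \<open>i \<le> n\<close> in \<open>t_rec\<close>.\<close>
  have t0: "t h 0 = 0" for h
    unfolding t_def T_def by (subst quadratic_series.simps) simp
  have t_rec: "t h n = (if n = 1 then L h else 0) + (\<Sum>i\<le>n. R (t h i) (t h (n - i)))" for h n
  proof -
    have "(\<Sum>i\<le>n. R (t h i) (t h (n - i))) = (\<Sum>i\<in>{1..<n}. R (t h i) (t h (n - i)))"
      by (rule sum.mono_neutral_right) (auto simp: t0 R.zero_left R.zero_right not_less Suc_le_eq le_Suc_eq)
    moreover have "t h n = (if n = 1 then L h else (\<Sum>i\<in>{1..<n}. R (t h i) (t h (n - i))))"
      unfolding t_def T_def
      by (subst quadratic_series.simps) (auto simp: min_def intro!: sum.cong)
    ultimately show ?thesis by auto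
  qed
  have eq: "z h = L h + R (z h) (z h)" if "norm h < r" for h
  proof -
    have "(\<lambda>n. (if n = 1 then L h else 0) + (\<Sum>i\<le>n. R (t h i) (t h (n - i)))) sums (L h + R (z h) (z h))"
      unfolding z_def using sums_single[of 1 "\<lambda>_. L h"]
      by (intro sums_add Cauchy_product_sums_bilinear[OF R] sm that) simp
    then have "t h sums (L h + R (z h) (z h))"
      unfolding t_rec[symmetric] .
    then show ?thesis by (simp add: z_def sums_iff)
  qed
  have "real_analytic_at z 0"
    unfolding real_analytic_at_def
  proof (intro exI conjI allI impI)
    show "0 < r" by (rule r)
    show "multilinear_bounded_by k (c k) T" for k by (rule T)
    show "summable (\<lambda>k. c k * r ^ k)" by (rule c)
    show "(\<lambda>k. T (replicate k h)) sums z (0 + h)" if "norm h < r" for h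
      using summable_sums[OF summable_norm_cancel[OF sm[OF that]]] by (simp add: z_def t_def)
  qed
  moreover have "t 0 n = 0" for n
    using norm_t[of 0 n] t0[of 0] by (cases n) auto
  then have "z 0 = 0" by (simp add: z_def)
  ultimately show thesis
    using that r(1) eq by blast
qed

section \<open>Uniqueness, and analyticity away from the origin\<close>

lemma bounded_bilinear_compose_left:
  assumes G: "bounded_linear G" and R: "bounded_bilinear R"
  shows "bounded_bilinear (\<lambda>x y. G (R x y))"
proof -
  interpret G: bounded_linear G by (rule G)
  interpret R: bounded_bilinear R by (rule R)
  obtain K where K: "0 \<le> K" "\<And>x. norm (G x) \<le> norm x * K"
    using G.nonneg_bounded by blast
  obtain M where M: "\<And>x y. norm (R x y) \<le> norm x * norm y * M"
    using R.bounded by blast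
  show ?thesis
  proof
    have "norm (G (R x y)) \<le> norm x * norm y * (M * K)" for x y
      using order_trans[OF K(2)[of "R x y"] mult_right_mono[OF M[of x y] K(1)]] by (simp add: mult.assoc)
    then show "\<exists>K. \<forall>x y. norm (G (R x y)) \<le> norm x * norm y * K" by blast
  qed (simp_all add: R.add_left R.add_right R.scaleR_left R.scaleR_right G.add G.scaleR)
qed

text \<open>The difference satisfies \<open>y - z = R (y - z) y + R z (y - z)\<close>, and in the
  ball the right side has norm at most \<open>2 * K * \<rho>\<close> times that of
  \<open>y - z\<close>.\<close>

lemma quadratic_equation_unique:
  assumes R: "bounded_bilinear R" and K: "\<And>x y. norm (R x y) \<le> K * (norm x * norm y)"
    and \<rho>: "norm y \<le> \<rho>" "norm z \<le> \<rho>" "2 * K * \<rho> < 1" "0 \<le> K"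
    and y: "y = l + R y y" and z: "z = l + R z z"
  shows "y = z"
proof -
  interpret R: bounded_bilinear R by (rule R)
  have "y - z = (l + R y y) - (l + R z z)"
    by (rule arg_cong2[OF y z])
  also have "\<dots> = R (y - z) y + R z (y - z)"
    by (simp add: R.diff_left R.diff_right)
  finally have "norm (y - z) = norm (R (y - z) y + R z (y - z))"
    by (rule arg_cong)
  also have "\<dots> \<le> K * (norm (y - z) * norm y) + K * (norm z * norm (y - z))"
    by (intro norm_triangle_le add_mono K)
  also have "\<dots> \<le> K * (norm (y - z) * \<rho>) + K * (\<rho> * norm (y - z))"
    using \<rho> by (intro add_mono mult_left_mono mult_right_mono) auto
  finally have "(1 - 2 * K * \<rho>) * norm (y - z) \<le> 0"
    by (simp add: algebra_simps)
  then show ?thesis using \<rho>(3) by (simp add: mult_le_0_iff)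
qed

text \<open>\<open>G x\<close> is the fixed point of the contraction sending \<open>g\<close> to
  \<open>x + D g\<close>; uniqueness of fixed points makes \<open>G\<close> linear.\<close>

lemma id_minus_contraction_inverse:
  fixes D :: "'z::banach \<Rightarrow> 'z"
  assumes D: "linear D" and c: "0 \<le> c" "c < 1" "\<And>x. norm (D x) \<le> c * norm x"
  obtains G where "bounded_linear G" "\<And>x. G x = x + D (G x)"
proof -
  interpret D: linear D by (rule D)
  have ex1: "\<exists>!g. x + D g = g" for x
    using c by (intro banach_fix_type[of c]) (auto simp: dist_norm D.diff[symmetric])
  then obtain G where G: "\<And>x. x + D (G x) = G x"
    by metis
  have eqI: "G x = g" if "x + D g = g" for x g
    using ex1[of x] G[of x] that by auto
  have "bounded_linear G"
  proof (rule bounded_linear_intro[of _ "1 / (1 - c)"])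
    show "G (x + y) = G x + G y" for x y
      by (rule eqI) (metis D.add G add.assoc add.left_commute)
    show "G (s *\<^sub>R x) = s *\<^sub>R G x" for s x
      by (rule eqI) (metis D.scaleR G scaleR_right_distrib)
    fix x
    have "norm (G x) \<le> norm x + c * norm (G x)"
      using norm_triangle_ineq[of x "D (G x)"] c(3)[of "G x"] by (simp add: G)
    then show "norm (G x) \<le> norm x * (1 / (1 - c))"
      using c by (simp add: field_simps)
  qed
  then show thesis using that G by metis
qed

lemma quadratic_equation_analytic_solution:
  fixes L :: "'e::real_normed_vector \<Rightarrow> 'z::banach"
  assumes L: "bounded_linear L" and R: "bounded_bilinear R"
  obtains z r \<rho> where "0 < r" "0 < \<rho>" "z 0 = 0"
    "\<And>h. norm h < r \<Longrightarrow> z h = L h + R (z h) (z h)"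
    "\<And>h. norm h < r \<Longrightarrow> real_analytic_at z h"
    "\<And>h y. norm h < r \<Longrightarrow> norm y < \<rho> \<Longrightarrow> y = L h + R y y \<Longrightarrow> y = z h"
proof -
  interpret L: bounded_linear L by (rule L)
  interpret R: bounded_bilinear R by (rule R)
  obtain K where K: "0 < K" "\<And>x y. norm (R x y) \<le> K * (norm x * norm y)"
    using R.pos_bounded by (auto simp: mult.commute)
  \<comment> \<open>With \<open>2 * K * \<rho> = 1 / 2\<close>, one radius serves both for
    uniqueness and for making \<open>D\<close> below a contraction.\<close>
  define \<rho> where "\<rho> = 1 / (4 * K)"
  have \<rho>: "0 < \<rho>" "2 * K * \<rho> < 1"
    using K by (auto simp: \<rho>_def)
  obtain z r0 where z: "0 < r0" "real_analytic_at z 0" "z 0 = 0"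
    "\<And>h. norm h < r0 \<Longrightarrow> z h = L h + R (z h) (z h)"
    using quadratic_equation_local_solution[OF L R] by metis
  have "\<forall>\<^sub>F h in nhds 0. norm (z h) < \<rho>"
    using isCont_tendsto_compose[OF isCont_norm[OF real_analytic_at_isCont[OF z(2)]], of "\<lambda>h. h" "nhds 0"] \<rho>(1)
    by (intro order_tendstoD) (auto simp: filterlim_ident z(3))
  then obtain r1 where r1: "0 < r1" "\<And>h. norm h < r1 \<Longrightarrow> norm (z h) < \<rho>"
    unfolding eventually_nhds_metric by (auto simp: dist_norm)
  define r where "r = min r0 r1"
  have r: "0 < r" "\<And>h. norm h < r \<Longrightarrow> norm (z h) < \<rho>"
      "\<And>h. norm h < r \<Longrightarrow> z h = L h + R (z h) (z h)"
    using z r1 by (auto simp: r_def)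
  have unique: "y = z h" if "norm h < r" "norm y < \<rho>" "y = L h + R y y" for h y
    using that r(2,3)[OF that(1)] \<rho> K
    by (intro quadratic_equation_unique[OF R K(2), of y \<rho> "z h" "L h"]) auto
  have analytic: "real_analytic_at z h" if h: "norm h < r" for h
  proof -
    \<comment> \<open>These are the cross terms of \<open>R (z h + y) (z h + y)\<close>. The
      increment satisfies \<open>y = L k + D y + R y y\<close>; applying the inverse
      \<open>G\<close> of \<open>1 - D\<close> restores the form solved locally.\<close>
    define D where "D y = R (z h) y + R y (z h)" for y
    have "linear D"
      unfolding D_def
      by (intro bounded_linear.linear bounded_linear_add R.bounded_linear_left R.bounded_linear_right)
    moreover have "norm (D y) \<le> (2 * K * \<rho>) * norm y" for y
    proof -
      have "norm (D y) \<le> K * (norm (z h) * norm y) + K * (norm y * norm (z h))"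
        unfolding D_def by (intro norm_triangle_le add_mono K)
      also have "\<dots> = (2 * K * norm (z h)) * norm y" by simp
      also have "\<dots> \<le> (2 * K * \<rho>) * norm y"
        using r(2)[OF h] K by (intro mult_right_mono mult_left_mono) auto
      finally show ?thesis .
    qed
    ultimately obtain G where G: "bounded_linear G" "\<And>x. G x = x + D (G x)"
      using id_minus_contraction_inverse[of D "2 * K * \<rho>"] \<rho> K by auto
    obtain y s where y: "0 < s" "real_analytic_at y 0" "y 0 = 0"
      "\<And>k. norm k < s \<Longrightarrow> y k = G (L k) + G (R (y k) (y k))"
    proof (rule quadratic_equation_local_solution)
      show "bounded_linear (\<lambda>k. G (L k))"
        by (rule bounded_linear_compose[OF G(1) L])
      show "bounded_bilinear (\<lambda>x y. G (R x y))"
        by (rule bounded_bilinear_compose_left[OF G(1) R])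
    qed blast
    have eq: "z h + y k = L (h + k) + R (z h + y k) (z h + y k)" if "norm k < s" for k
    proof -
      have "y k = G (L k + R (y k) (y k))"
        using y(4)[OF that] by (simp add: linear_add[OF bounded_linear.linear[OF G(1)]])
      then have "y k = L k + R (y k) (y k) + D (y k)"
        using G(2) by metis
      then have "z h + y k = (L h + R (z h) (z h)) + (L k + R (y k) (y k) + D (y k))"
        using r(3)[OF h] by metis
      also have "\<dots> = L (h + k) + R (z h + y k) (z h + y k)"
        by (simp add: D_def L.add R.add_left R.add_right add_ac)
      finally show ?thesis .
    qed
    have "((\<lambda>k. norm (z h + y k)) \<longlongrightarrow> norm (z h + 0)) (nhds 0)"
      using isCont_tendsto_compose[OF real_analytic_at_isCont[OF y(2)], of "\<lambda>h. h" "nhds 0"]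
      by (intro tendsto_intros) (auto simp: filterlim_ident y(3))
    then have ev1: "\<forall>\<^sub>F k in nhds 0. norm (z h + y k) < \<rho>"
      using r(2)[OF h] by (auto dest: order_tendstoD)
    have "((\<lambda>k. norm (h + k)) \<longlongrightarrow> norm (h + 0)) (nhds 0)"
      by (intro tendsto_intros filterlim_ident)
    then have ev2: "\<forall>\<^sub>F k in nhds 0. norm (h + k) < r"
      using h by (auto dest: order_tendstoD)
    have ev3: "\<forall>\<^sub>F k in nhds (0::'e). norm k < s"
      using y(1) by (auto simp: eventually_nhds_metric dist_norm)
    \<comment> \<open>For small \<open>k\<close>, \<open>z h + y k\<close> solves the original
      equation at \<open>h + k\<close> inside the uniqueness ball, so it must be
      \<open>z (h + k)\<close>.\<close>
    have "\<forall>\<^sub>F k in nhds 0. z (h + k) = z h + y (0 + k)"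
      using ev1 ev2 ev3
    proof eventually_elim
      case (elim k)
      then show ?case using unique[of "h + k" "z h + y k"] eq[of k] by simp
    qed
    then show ?thesis
      by (rule real_analytic_at_affine_compose[OF y(2) bounded_linear_ident])
  qed
  show thesis
    by (rule that[OF r(1) \<rho>(1) z(3) r(3) analytic unique])
qed

section \<open>Bounded bilinear maps and pullbacks\<close>

lemma bounded_bilinear_add:
  assumes "bounded_bilinear f" "bounded_bilinear g"
  shows "bounded_bilinear (\<lambda>x y. f x y + g x y)"
proof -
  interpret f: bounded_bilinear f by fact
  interpret g: bounded_bilinear g by fact
  obtain K L where "\<And>x y. norm (f x y) \<le> norm x * norm y * K" "\<And>x y. norm (g x y) \<le> norm x * norm y * L"
    using f.bounded g.bounded by blast
  then have "norm (f x y + g x y) \<le> norm x * norm y * (K + L)" for x y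
    unfolding ring_distribs by (intro norm_triangle_le add_mono)
  then have "\<exists>K. \<forall>x y. norm (f x y + g x y) \<le> norm x * norm y * K" by blast
  then show ?thesis
    by unfold_locales
      (simp_all add: f.add_left f.add_right g.add_left g.add_right f.scaleR_left f.scaleR_right
        g.scaleR_left g.scaleR_right scaleR_right_distrib)
qed

lemma bounded_bilinear_zero: "bounded_bilinear (\<lambda>x y. 0)"
  by unfold_locales (auto intro: exI[of _ 0])

lemma bounded_bilinear_sum:
  assumes "\<And>i. i \<in> S \<Longrightarrow> bounded_bilinear (f i)"
  shows "bounded_bilinear (\<lambda>x y. \<Sum>i\<in>S. f i x y)"
  using assms
  by (induction S rule: infinite_finite_induct) (auto intro: bounded_bilinear_zero bounded_bilinear_add)

lemma bounded_bilinear_minus: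
  assumes "bounded_bilinear f"
  shows "bounded_bilinear (\<lambda>x y. - f x y)"
  by (rule bounded_bilinear_compose_left[OF bounded_linear_minus[OF bounded_linear_ident] assms])

lemma bounded_bilinear_diff:
  assumes "bounded_bilinear f" "bounded_bilinear g"
  shows "bounded_bilinear (\<lambda>x y. f x y - g x y)"
  using bounded_bilinear_add[OF assms(1) bounded_bilinear_minus[OF assms(2)]] by simp

lemma bounded_bilinear_Pair:
  assumes "bounded_bilinear f" "bounded_bilinear g"
  shows "bounded_bilinear (\<lambda>x y. (f x y, g x y))"
proof -
  have "bounded_linear (\<lambda>z. (z, 0))" "bounded_linear (\<lambda>z. (0, z))"
    by (auto intro!: bounded_linear_Pair bounded_linear_ident bounded_linear_zero)
  from bounded_bilinear_add[OF bounded_bilinear_compose_left[OF this(1) assms(1)]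
      bounded_bilinear_compose_left[OF this(2) assms(2)]]
  show ?thesis by simp
qed

lemma bounded_linear_axis: "bounded_linear (\<lambda>x::'a::real_normed_vector. (axis i x :: 'a ^ 'n::finite))"
proof (rule bounded_linear_intro[of _ 1])
  show "norm (axis i x :: 'a ^ 'n) \<le> norm x * 1" for x :: 'a
    using L2_set_le_sum[of UNIV "\<lambda>j. norm ((axis i x :: 'a ^ 'n) $ j)"]
    by (simp add: norm_vec_def axis_def if_distrib[of norm] cong: if_cong)
qed (auto simp: axis_def vec_eq_iff)

text \<open>Reduces boundedness of vector-valued maps to that of finite sums.\<close>

lemma vec_lambda_eq_sum_axis: "(\<chi> i. f i) = (\<Sum>i\<in>UNIV. axis i (f i))"
  by (simp add: vec_eq_iff axis_def)

lemma bounded_linear_vec_lambda: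
  fixes f :: "'n::finite \<Rightarrow> 'a::real_normed_vector \<Rightarrow> 'b::real_normed_vector"
  assumes "\<And>i. bounded_linear (f i)"
  shows "bounded_linear (\<lambda>x. \<chi> i. f i x)"
  unfolding vec_lambda_eq_sum_axis
  by (intro bounded_linear_sum bounded_linear_compose[OF bounded_linear_axis] assms)

lemma bounded_bilinear_vec_lambda:
  fixes f :: "'n::finite \<Rightarrow> 'a::real_normed_vector \<Rightarrow> 'b::real_normed_vector \<Rightarrow> 'c::real_normed_vector"
  assumes "\<And>i. bounded_bilinear (f i)"
  shows "bounded_bilinear (\<lambda>x y. \<chi> i. f i x y)"
  unfolding vec_lambda_eq_sum_axis
  by (intro bounded_bilinear_sum bounded_bilinear_compose_left[OF bounded_linear_axis] assms)

text \<open>Places both parameter-dependent forms on the same space. Restricting the two arguments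
  along the embedding is a bounded linear operation on forms, so linear dependence on the parameter
  survives.\<close>

lemma pullback_forms:
  fixes \<iota> :: "'v::real_normed_vector \<Rightarrow> 'h::real_normed_vector"
    and b :: "'y::real_normed_vector \<Rightarrow>\<^sub>L 'h bform"
  assumes "bounded_linear \<iota>"
  obtains b' :: "'y \<Rightarrow>\<^sub>L 'v bform" where "\<And>\<epsilon> u v. b' \<epsilon> u v = restrict_form \<iota> (b \<epsilon>) u v"
proof -
  define J where "J = Blinfun \<iota>"
  have J: "blinfun_apply J = \<iota>"
    unfolding J_def by (rule bounded_linear_Blinfun_apply) fact
  define P :: "('h \<Rightarrow>\<^sub>L real) \<Rightarrow>\<^sub>L ('v \<Rightarrow>\<^sub>L real)" where "P = Blinfun (\<lambda>f. f o\<^sub>L J)"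
  have P: "blinfun_apply P = (\<lambda>f. f o\<^sub>L J)"
    unfolding P_def
    by (rule bounded_linear_Blinfun_apply[OF bounded_bilinear.bounded_linear_left[OF bounded_bilinear_blinfun_compose]])
  define Q :: "'h bform \<Rightarrow>\<^sub>L 'v bform" where "Q = Blinfun (\<lambda>q. P o\<^sub>L (q o\<^sub>L J))"
  have Q: "blinfun_apply Q = (\<lambda>q. P o\<^sub>L (q o\<^sub>L J))"
    unfolding Q_def
    by (intro bounded_linear_Blinfun_apply
        bounded_linear_compose[OF bounded_bilinear.bounded_linear_right[OF bounded_bilinear_blinfun_compose]]
        bounded_bilinear.bounded_linear_left[OF bounded_bilinear_blinfun_compose])
  have "(Q o\<^sub>L b) \<epsilon> u v = restrict_form \<iota> (b \<epsilon>) u v" for \<epsilon> u v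
    by (simp add: Q P J restrict_form_def)
  then show thesis by (rule that)
qed

section \<open>The linearisation at the eigenspace\<close>

text \<open>
  A sequence of unit vectors along which \<open>T\<close> tends to \<open>0\<close> would, by the Garding inequality and
  compactness, have a convergent subsequence, whose limit is a unit vector in the kernel of \<open>T\<close>.
\<close>

lemma garding_bounded_below:
  fixes T :: "'v::{real_normed_vector,complete_space} bform" and \<iota> :: "'v \<Rightarrow> 'h::real_normed_vector"
  assumes \<iota>: "linear \<iota>" "\<And>S. bounded S \<Longrightarrow> compact (closure (\<iota> ` S))"
    and \<alpha>: "0 < \<alpha>" and K: "0 \<le> K" and garding: "\<And>u. \<alpha> * (norm u)\<^sup>2 \<le> T u u + K * (norm (\<iota> u))\<^sup>2"
    and inj: "\<And>u. blinfun_apply T u = 0 \<Longrightarrow> u = 0"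
  obtains c where "0 < c" "\<And>u. c * norm u \<le> norm (T u)"
proof -
  have "\<exists>c>0. \<forall>u. c * norm u \<le> norm (T u)"
  proof (rule ccontr)
    assume "\<not> ?thesis"
    then have ex: "\<exists>u. norm (T u) < c * norm u" if "0 < c" for c
      using that by (meson not_le)
    have "\<exists>w. norm w = 1 \<and> norm (T w) < inverse (real (Suc n))" for n
    proof -
      obtain u where u: "norm (T u) < inverse (real (Suc n)) * norm u"
        using ex[of "inverse (real (Suc n))"] by auto
      then have "u \<noteq> 0" by auto
      with u have "norm (u /\<^sub>R norm u) = 1 \<and> norm (T (u /\<^sub>R norm u)) < inverse (real (Suc n))"
        by (simp add: blinfun.scaleR_right field_simps)
      then show ?thesis ..
    qed
    then obtain w where w: "\<And>n. norm (w n) = 1" "\<And>n. norm (T (w n)) < inverse (real (Suc n))"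
      by metis
    have "bounded (range w)"
      by (rule boundedI[of _ 1]) (auto simp: w(1))
    then have "seq_compact (closure (\<iota> ` range w))"
      using \<iota>(2) compact_imp_seq_compact by blast
    moreover have "\<forall>n. \<iota> (w n) \<in> closure (\<iota> ` range w)"
      using closure_subset by fastforce
    ultimately obtain l r where r: "strict_mono r" and l: "((\<lambda>n. \<iota> (w n)) \<circ> r) \<longlonglongrightarrow> l"
      by (rule seq_compactE)
    define x where "x n = w (r n)" for n
    have Tx: "(\<lambda>n. norm (T (x n))) \<longlonglongrightarrow> 0"
    proof (rule tendsto_sandwich[of "\<lambda>_. 0" _ _ "\<lambda>n. inverse (real (Suc (r n)))"])
      show "(\<lambda>n. inverse (real (Suc (r n)))) \<longlonglongrightarrow> 0"
        using LIMSEQ_subseq_LIMSEQ[OF LIMSEQ_inverse_real_of_nat r] by (simp add: o_def)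
      show "\<forall>\<^sub>F n in sequentially. norm (T (x n)) \<le> inverse (real (Suc (r n)))"
        unfolding x_def by (intro always_eventually allI less_imp_le w(2))
    qed auto
    have \<iota>x: "Cauchy (\<lambda>n. \<iota> (x n))"
      using LIMSEQ_imp_Cauchy[OF l] by (simp add: x_def o_def)
    \<comment> \<open>The Garding inequality for a difference of two unit vectors, whose norm is at
      most 2.\<close>
    have est: "\<alpha> * (norm (x m - x n))\<^sup>2 \<le> 2 * norm (T (x m)) + 2 * norm (T (x n)) + K * (norm (\<iota> (x m) - \<iota> (x n)))\<^sup>2"
      for m n
    proof -
      have "norm (x m - x n) \<le> 2"
        using norm_triangle_ineq4[of "x m" "x n"] by (simp add: x_def w(1))
      have "T (x m - x n) (x m - x n) \<le> norm (T (x m - x n)) * norm (x m - x n)"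
        using norm_blinfun[of "T (x m - x n)" "x m - x n"] by simp
      also have "\<dots> \<le> norm (T (x m - x n)) * 2"
        using \<open>norm (x m - x n) \<le> 2\<close> by (rule mult_left_mono) simp
      also have "\<dots> \<le> 2 * norm (T (x m)) + 2 * norm (T (x n))"
        using norm_triangle_ineq4[of "T (x m)" "T (x n)"] by (simp add: blinfun.diff_right)
      finally show ?thesis
        using garding[of "x m - x n"] by (simp add: linear_diff[OF \<iota>(1)])
    qed
    have "Cauchy x"
    proof (rule metric_CauchyI)
      fix e :: real assume e: "0 < e"
      \<comment> \<open>The terms of \<open>est\<close> will be below \<open>2 * d\<close>, below
        \<open>2 * d\<close> and at most \<open>K * d\<close>; \<open>5 + K\<close> leaves
        room.\<close>
      define d where "d = \<alpha> * e\<^sup>2 / (5 + K)"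
      define q where "q = sqrt d"
      have d: "0 < d" "0 < q" "q\<^sup>2 = d" "(5 + K) * d = \<alpha> * e\<^sup>2"
        using \<alpha> K e by (auto simp: d_def q_def)
      obtain N where N: "\<And>n. N \<le> n \<Longrightarrow> norm (T (x n)) < d"
        using order_tendstoD(2)[OF Tx d(1)] by (auto simp: eventually_sequentially)
      obtain M where M: "\<And>m n. M \<le> m \<Longrightarrow> M \<le> n \<Longrightarrow> norm (\<iota> (x m) - \<iota> (x n)) < q"
        using \<iota>x d(2) unfolding Cauchy_def dist_norm by metis
      have "dist (x m) (x n) < e" if "max M N \<le> m" "max M N \<le> n" for m n
      proof -
        have "(norm (\<iota> (x m) - \<iota> (x n)))\<^sup>2 \<le> q\<^sup>2"
          using M[of m n] that by (intro power_mono) auto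
        then have "K * (norm (\<iota> (x m) - \<iota> (x n)))\<^sup>2 \<le> K * d"
          using K d by (simp add: mult_left_mono)
        then have "\<alpha> * (norm (x m - x n))\<^sup>2 < (5 + K) * d"
          using est[of m n] N[of m] N[of n] that d(1) by (simp add: algebra_simps)
        then have "(norm (x m - x n))\<^sup>2 < e\<^sup>2"
          using \<alpha> by (simp add: d(4))
        then show ?thesis using e by (simp add: dist_norm power2_less_imp_less)
      qed
      then show "\<exists>M. \<forall>m\<ge>M. \<forall>n\<ge>M. dist (x m) (x n) < e" by blast
    qed
    then obtain y where y: "x \<longlonglongrightarrow> y"
      using Cauchy_convergent convergent_def by blast
    have "(\<lambda>n. norm (T (x n))) \<longlonglongrightarrow> norm (T y)"
      by (intro tendsto_intros blinfun.tendsto y)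
    then have "norm (T y) = 0"
      using Tx LIMSEQ_unique by blast
    then have "y = 0" using inj by simp
    have "(\<lambda>n. norm (x n)) \<longlonglongrightarrow> norm y"
      by (intro tendsto_intros y)
    then have "norm y = 1"
      by (simp add: x_def w(1) LIMSEQ_const_iff)
    with \<open>y = 0\<close> show False by simp
  qed
  then show thesis using that by blast
qed

text \<open>Injectivity: testing \<open>T w = 0\<close> on the eigenbasis removes
  \<open>a - l b\<close> by symmetry and leaves \<open>b(w, u_k) = 0\<close>. Then \<open>w\<close>
  is an eigenvector orthogonal to the eigenspace, so \<open>b(w, w)\<close> and with it
  \<open>a(w, w)\<close> vanish, and ellipticity of \<open>A\<close> gives
  \<open>w = 0\<close>.\<close>

lemma eigenspace_isomorphism:
  fixes \<iota> :: "'v::{real_inner,complete_space} \<Rightarrow> 'h::real_normed_vector"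
    and A :: "'v bform" and B :: "'h bform" and B' :: "'v bform" and u :: "'v ^ 'm::finite"
  assumes \<iota>: "dense_compact_embedding \<iota>"
    and A: "symmetric_form A" "elliptic_form A" and B: "symmetric_form B"
    and B': "\<And>u v. B' u v = restrict_form \<iota> B u v"
    and u: "orthonormal_basis_of B' {u. A u = l *\<^sub>R B' u} u"
  obtains N :: "('v \<Rightarrow>\<^sub>L real) \<Rightarrow>\<^sub>L 'v"
  where "\<And>f. A (N f) - l *\<^sub>R B' (N f) + (\<Sum>k\<in>UNIV. B' (N f) (u $ k) *\<^sub>R B' (u $ k)) = f"
    "\<And>w. N (A w - l *\<^sub>R B' w + (\<Sum>k\<in>UNIV. B' w (u $ k) *\<^sub>R B' (u $ k))) = w"
proof -
  define T where "T = Blinfun (\<lambda>w. A w - l *\<^sub>R B' w + (\<Sum>k\<in>UNIV. B' w (u $ k) *\<^sub>R B' (u $ k)))"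
  have T: "T w = A w - l *\<^sub>R B' w + (\<Sum>k\<in>UNIV. B' w (u $ k) *\<^sub>R B' (u $ k))" for w
    unfolding T_def
    by (subst bounded_linear_Blinfun_apply)
      (auto intro!: bounded_linear_add bounded_linear_sub bounded_linear_sum bounded_linear_const_scaleR
        bounded_linear_scaleR_const blinfun.bounded_linear_right
        bounded_linear_compose[OF blinfun.bounded_linear_left])
  have symA: "A v w = A w v" and symB: "B' v w = B' w v" for v w
    using A(1) B by (simp_all add: symmetric_form_def B' restrict_form_def)
  have T_apply: "T w v = A w v - l * B' w v + (\<Sum>k\<in>UNIV. B' w (u $ k) * B' (u $ k) v)" for w v
    by (simp add: T blinfun.add_left blinfun.diff_left blinfun.scaleR_left blinfun.sum_left)
  have sym: "symmetric_form T"
    unfolding symmetric_form_def T_apply by (simp add: symA symB mult.commute)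
  have orth: "B' (u $ i) (u $ j) = (if i = j then 1 else 0)" for i j
    using u by (simp add: orthonormal_basis_of_def)
  have span: "span (range (\<lambda>i. u $ i)) = {u. A u = l *\<^sub>R B' u}"
    using u by (simp add: orthonormal_basis_of_def)
  have Au: "A (u $ i) = l *\<^sub>R B' (u $ i)" for i
    using span span_base[of "u $ i" "range (\<lambda>i. u $ i)"] by auto
  have inj: "w = 0" if "blinfun_apply T w = 0" for w
  proof -
    have Bw: "B' w (u $ i) = 0" for i
    proof -
      have "T w (u $ i) = B' w (u $ i)"
        by (simp add: T_apply orth symA[of w] Au symB[of w] blinfun.scaleR_left if_distrib cong: if_cong)
      then show ?thesis using that by simp
    qed
    with that have "A w = l *\<^sub>R B' w"
      by (simp add: T)
    then have "w \<in> span (range (\<lambda>i. u $ i))"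
      using span by simp
    moreover have "B' w v = 0" if "v \<in> span (range (\<lambda>i. u $ i))" for v
      using that by (induction rule: span_induct_alt) (auto simp: Bw blinfun.add_right blinfun.scaleR_right)
    ultimately have "B' w w = 0" by blast
    with \<open>A w = l *\<^sub>R B' w\<close> have "A w w = 0"
      by (simp add: blinfun.scaleR_left)
    moreover obtain \<alpha> where "0 < \<alpha>" "\<alpha> * (norm w)\<^sup>2 \<le> A w w"
      using A(2) unfolding elliptic_form_def by blast
    ultimately show ?thesis by (simp add: mult_le_0_iff)
  qed
  obtain \<alpha> where \<alpha>: "0 < \<alpha>" "\<And>w. \<alpha> * (norm w)\<^sup>2 \<le> A w w"
    using A(2) unfolding elliptic_form_def by blast
  have garding: "\<alpha> * (norm w)\<^sup>2 \<le> T w w + (\<bar>l\<bar> * norm B) * (norm (\<iota> w))\<^sup>2" for w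
  proof -
    have "\<bar>B (\<iota> w) (\<iota> w)\<bar> \<le> norm (B (\<iota> w)) * norm (\<iota> w)"
      using norm_blinfun[of "B (\<iota> w)" "\<iota> w"] by simp
    also have "\<dots> \<le> norm B * norm (\<iota> w) * norm (\<iota> w)"
      by (intro mult_right_mono norm_blinfun) simp
    finally have "\<bar>l\<bar> * \<bar>B' w w\<bar> \<le> \<bar>l\<bar> * (norm B * (norm (\<iota> w))\<^sup>2)"
      by (intro mult_left_mono) (auto simp: B' restrict_form_def power2_eq_square mult.assoc)
    moreover have "l * B' w w \<le> \<bar>l\<bar> * \<bar>B' w w\<bar>"
      by (metis abs_ge_self abs_mult)
    \<comment> \<open>The projection contributes a sum of squares, so only the term with
      \<open>l\<close> has to be absorbed by the norm of \<open>\<iota> w\<close>.\<close>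
    moreover have "0 \<le> (\<Sum>k\<in>UNIV. B' w (u $ k) * B' (u $ k) w)"
      by (simp add: symB[of w] sum_nonneg)
    ultimately show ?thesis
      using \<alpha>(2)[of w] by (simp add: T_apply mult.assoc)
  qed
  obtain c where c: "0 < c" "\<And>u. c * norm u \<le> norm (T u)"
    using garding_bounded_below[OF _ _ \<alpha>(1) _ garding inj] \<iota>
    unfolding dense_compact_embedding_def bounded_linear_def by auto
  obtain N where "\<And>f. T (blinfun_apply N f) = f" "\<And>w. blinfun_apply N (T w) = w"
    using symmetric_bounded_below_inverse[OF sym c] by blast
  then show thesis
    by (intro that[of N]) (simp_all only: T)
qed

section \<open>Continuation of the eigenbasis\<close>

text \<open>
  \<open>N\<close> inverts \<open>w \<mapsto> a(w, \<cdot>) - \<lambda>\<^sub>0 b(w, \<cdot>) + \<Sum>\<^sub>k b(w, u\<^sub>k) b(u\<^sub>k, \<cdot>)\<close> at the base point. The unknown is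
  \<open>\<phi>\<close> with \<open>N \<phi>\<^sub>j = w\<^sub>j - \<Sum>\<^sub>k \<Lambda>\<^sub>k\<^sub>j u\<^sub>k\<close>, where \<open>w\<close> and \<open>\<Lambda>\<close> are the increments of \<open>u\<close> and \<open>\<lambda>\<close>. It encodes
  both: \<open>\<Lambda>\<^sub>k\<^sub>j = - b(N \<phi>\<^sub>j, u\<^sub>k)\<close> since \<open>w\<^sub>j\<close> is orthogonal to all \<open>u\<^sub>k\<close>. The unknown lives in the dual
  because the sort of \<open>'v\<close> in the theorem does not include \<^class>\<open>banach\<close>.
\<close>

locale eigenbasis_continuation =
  fixes a :: "'x::banach \<Rightarrow>\<^sub>L ('v::real_normed_vector) bform" and b :: "'y::banach \<Rightarrow>\<^sub>L 'v bform"
    and \<mu>0 :: 'x and \<epsilon>0 :: 'y and lam0 :: real and u0 :: "'v ^ 'm::finite"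
    and N :: "('v \<Rightarrow>\<^sub>L real) \<Rightarrow>\<^sub>L 'v"
  assumes orthonormal: "b \<epsilon>0 (u0 $ i) (u0 $ j) = (if i = j then 1 else 0)"
    and eigen: "a \<mu>0 (u0 $ j) = lam0 *\<^sub>R b \<epsilon>0 (u0 $ j)"
    and right_inverse:
      "a \<mu>0 (N f) - lam0 *\<^sub>R b \<epsilon>0 (N f) + (\<Sum>k\<in>UNIV. b \<epsilon>0 (N f) (u0 $ k) *\<^sub>R b \<epsilon>0 (u0 $ k)) = f"
    and left_inverse:
      "N (a \<mu>0 w - lam0 *\<^sub>R b \<epsilon>0 w + (\<Sum>k\<in>UNIV. b \<epsilon>0 w (u0 $ k) *\<^sub>R b \<epsilon>0 (u0 $ k))) = w"
begin

definition M :: "'v \<Rightarrow> ('v \<Rightarrow>\<^sub>L real)" where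
  "M w = a \<mu>0 w - lam0 *\<^sub>R b \<epsilon>0 w + (\<Sum>k\<in>UNIV. b \<epsilon>0 w (u0 $ k) *\<^sub>R b \<epsilon>0 (u0 $ k))"

definition coef :: "('v \<Rightarrow>\<^sub>L real) \<Rightarrow> 'm \<Rightarrow> real" where
  "coef f k = b \<epsilon>0 (N f) (u0 $ k)"

definition rest :: "('v \<Rightarrow>\<^sub>L real) \<Rightarrow> 'v" where
  "rest f = N f - (\<Sum>k\<in>UNIV. coef f k *\<^sub>R (u0 $ k))"

definition decode :: "(('v \<Rightarrow>\<^sub>L real) ^ 'm) \<Rightarrow> ('v ^ 'm) \<times> (real ^ 'm ^ 'm)" where
  "decode \<phi> = ((\<chi> j. rest (\<phi> $ j)), (\<chi> k j. - coef (\<phi> $ j) k))"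

definition encode :: "('v ^ 'm) \<times> (real ^ 'm ^ 'm) \<Rightarrow> (('v \<Rightarrow>\<^sub>L real) ^ 'm)" where
  "encode d = (\<chi> j. M (fst d $ j - (\<Sum>k\<in>UNIV. snd d $ k $ j *\<^sub>R (u0 $ k))))"

definition solves :: "'x \<Rightarrow> 'y \<Rightarrow> ('v ^ 'm) \<times> (real ^ 'm ^ 'm) \<Rightarrow> bool" where
  "solves \<mu> \<epsilon> d \<longleftrightarrow>
     (\<forall>j. a \<mu> (fst d $ j) = (\<Sum>k\<in>UNIV. snd d $ k $ j *\<^sub>R b \<epsilon> (fst d $ k)))"

text \<open>The parameter increment is copied into the state. Products of parameter and unknown then
  belong to one fixed bilinear map, at the price of a trivial first equation. The second component
  is the first-order defect of the unperturbed eigenbasis.\<close>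

definition lin :: "'x \<times> 'y \<Rightarrow> ('x \<times> 'y) \<times> (('v \<Rightarrow>\<^sub>L real) ^ 'm) \<times> (('v \<Rightarrow>\<^sub>L real) ^ 'm)" where
  "lin h = (h, (\<chi> j. lam0 *\<^sub>R b (snd h) (u0 $ j) - a (fst h) (u0 $ j)), 0)"

text \<open>
  In terms of \<open>\<phi>\<close> the equation is cubic in the unknown and the parameter increment \<open>h\<close>. It becomes quadratic in
  \<open>(h, \<phi>, s)\<close> with the auxiliary unknown \<open>s\<^sub>k = b(w\<^sub>k, \<cdot>; h)\<close>.
\<close>

definition quad ::
  "('x \<times> 'y) \<times> (('v \<Rightarrow>\<^sub>L real) ^ 'm) \<times> (('v \<Rightarrow>\<^sub>L real) ^ 'm) \<Rightarrow>
   ('x \<times> 'y) \<times> (('v \<Rightarrow>\<^sub>L real) ^ 'm) \<times> (('v \<Rightarrow>\<^sub>L real) ^ 'm) \<Rightarrow>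
   ('x \<times> 'y) \<times> (('v \<Rightarrow>\<^sub>L real) ^ 'm) \<times> (('v \<Rightarrow>\<^sub>L real) ^ 'm)" where
  "quad z z' =
     (0,
      (\<chi> j. lam0 *\<^sub>R b (snd (fst z)) (rest (fst (snd z') $ j)) - a (fst (fst z)) (rest (fst (snd z') $ j))
         - (\<Sum>k\<in>UNIV. coef (fst (snd z) $ j) k *\<^sub>R
             (b (snd (fst z')) (u0 $ k) + b \<epsilon>0 (rest (fst (snd z') $ k)) + snd (snd z') $ k))),
      (\<chi> k. b (snd (fst z)) (rest (fst (snd z') $ k))))"

lemma bounded_linear_M: "bounded_linear M"
  unfolding M_def
  by (intro bounded_linear_add bounded_linear_sub bounded_linear_sum bounded_linear_const_scaleR
      bounded_linear_scaleR_const blinfun.bounded_linear_right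
      bounded_linear_compose[OF blinfun.bounded_linear_left])

lemma bounded_linear_coef: "bounded_linear (\<lambda>f. coef f k)"
  unfolding coef_def
  by (intro blinfun.bounded_linear_right bounded_linear_blinfun_apply
      bounded_linear_compose[OF blinfun.bounded_linear_left])

lemma bounded_linear_rest: "bounded_linear rest"
  unfolding rest_def
  by (intro bounded_linear_sub bounded_linear_sum bounded_linear_scaleR_const bounded_linear_coef
      blinfun.bounded_linear_right)

lemma bounded_linear_decode: "bounded_linear decode"
  unfolding decode_def
  by (intro bounded_linear_Pair bounded_linear_vec_lambda bounded_linear_minus bounded_linear_vec_nth
      bounded_linear_compose[OF bounded_linear_rest] bounded_linear_compose[OF bounded_linear_coef])

lemma bounded_linear_encode: "bounded_linear encode"
  unfolding encode_def
  by (intro bounded_linear_vec_lambda bounded_linear_compose[OF bounded_linear_M] bounded_linear_sub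
      bounded_linear_sum bounded_linear_scaleR_const
      bounded_linear_compose[OF bounded_linear_vec_nth] bounded_linear_fst bounded_linear_snd)

lemma bounded_linear_lin: "bounded_linear lin"
  unfolding lin_def
  by (intro bounded_linear_Pair bounded_linear_vec_lambda bounded_linear_sub bounded_linear_ident
      bounded_linear_zero bounded_linear_const_scaleR
      bounded_linear_compose[OF blinfun.bounded_linear_left] bounded_linear_blinfun_apply
      bounded_linear_fst bounded_linear_snd)

text \<open>Each product in \<open>quad\<close> takes one factor from \<open>z\<close> and the other
  from \<open>z'\<close>; the eigenvalue equation itself is read off on the diagonal.\<close>

lemma bounded_bilinear_quad: "bounded_bilinear quad"
proof -
  note linear_intros = bounded_linear_add bounded_linear_vec_nth bounded_linear_fst bounded_linear_snd
    bounded_linear_blinfun_apply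
    bounded_linear_compose[OF bounded_linear_vec_nth] bounded_linear_compose[OF bounded_linear_fst]
    bounded_linear_compose[OF bounded_linear_snd] bounded_linear_compose[OF bounded_linear_rest]
    bounded_linear_compose[OF bounded_linear_coef] bounded_linear_compose[OF blinfun.bounded_linear_left]
  show ?thesis
    unfolding quad_def
    by (intro bounded_bilinear_Pair bounded_bilinear_zero bounded_bilinear_vec_lambda
        bounded_bilinear_diff bounded_bilinear_sum
        bounded_bilinear_compose_left[OF bounded_linear_scaleR_right]
        bounded_bilinear.comp[OF bounded_bilinear_blinfun_apply]
        bounded_bilinear.comp[OF bounded_bilinear_scaleR] linear_intros)
qed

section \<open>Equivalence of the eigenvalue equation and the quadratic equation\<close>

lemma M_eigenbasis: "M (u0 $ k) = b \<epsilon>0 (u0 $ k)"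
  by (simp add: M_def eigen orthonormal if_distrib[of "\<lambda>c. c *\<^sub>R _"] cong: if_cong)

lemma rest_orthogonal: "b \<epsilon>0 (rest f) (u0 $ k) = 0"
  by (simp add: rest_def coef_def[symmetric] blinfun.diff_right blinfun.diff_left blinfun.sum_right
      blinfun.sum_left blinfun.scaleR_right blinfun.scaleR_left orthonormal if_distrib cong: if_cong)

text \<open>Apply \<open>M\<close> to the splitting of \<open>N f\<close> into \<open>rest f\<close>
  and its eigenbasis part: on the former the projection drops out, on the latter only the projection
  survives. Consequently the terms of first order in both increments add up to the unknown
  functional itself.\<close>

lemma functional_decomposition:
  "a \<mu>0 (rest f) - lam0 *\<^sub>R b \<epsilon>0 (rest f) + (\<Sum>k\<in>UNIV. coef f k *\<^sub>R b \<epsilon>0 (u0 $ k)) = f"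
proof -
  interpret M: bounded_linear M by (rule bounded_linear_M)
  have "f = M (rest f + (\<Sum>k\<in>UNIV. coef f k *\<^sub>R (u0 $ k)))"
    using right_inverse[of f] by (simp add: rest_def M_def)
  also have "\<dots> = M (rest f) + (\<Sum>k\<in>UNIV. coef f k *\<^sub>R b \<epsilon>0 (u0 $ k))"
    by (simp add: M.add M.sum M.scaleR M_eigenbasis)
  also have "M (rest f) = a \<mu>0 (rest f) - lam0 *\<^sub>R b \<epsilon>0 (rest f)"
    by (simp add: M_def rest_orthogonal)
  finally show ?thesis by simp
qed

text \<open>Serves uniqueness, where a competing trajectory must be turned into a solution of the
  quadratic equation. Orthogonality lets \<open>coef\<close> read off the matrix increment
  exactly.\<close>

lemma decode_encode:
  assumes "\<And>j k. b \<epsilon>0 (fst d $ j) (u0 $ k) = 0"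
  shows "decode (encode d) = d"
proof -
  have N: "N (encode d $ j) = fst d $ j - (\<Sum>k\<in>UNIV. snd d $ k $ j *\<^sub>R (u0 $ k))" for j
    using left_inverse by (simp add: encode_def M_def)
  have coef: "coef (encode d $ j) k = - snd d $ k $ j" for j k
    by (simp add: coef_def N assms blinfun.diff_right blinfun.diff_left blinfun.sum_right
      blinfun.sum_left blinfun.scaleR_right blinfun.scaleR_left orthonormal if_distrib cong: if_cong)
  show ?thesis
    by (simp add: decode_def prod_eq_iff vec_eq_iff rest_def coef N sum_negf)
qed

text \<open>The existential adds no freedom: the third component of the equation forces
  \<open>s\<close>. Substituting it turns the quadratic term \<open>coef * s\<close> into the cubic
  one of the eigenvalue equation.\<close>

lemma solves_iff:
  "solves (\<mu>0 + fst h) (\<epsilon>0 + snd h) ((u0, lam0 *\<^sub>R mat 1) + decode \<phi>) \<longleftrightarrow>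
     (\<exists>s. (h, \<phi>, s) = lin h + quad (h, \<phi>, s) (h, \<phi>, s))"
proof -
  define w where "w j = rest (\<phi> $ j)" for j
  define c where "c j k = coef (\<phi> $ j) k" for j k
  define s where "s k = b (snd h) (w k)" for k
  have phi: "\<phi> $ j = a \<mu>0 (w j) - lam0 *\<^sub>R b \<epsilon>0 (w j) + (\<Sum>k\<in>UNIV. c j k *\<^sub>R b \<epsilon>0 (u0 $ k))" for j
    using functional_decomposition[of "\<phi> $ j"] by (simp add: w_def c_def)
  have lam: "(\<Sum>k\<in>UNIV. (lam0 *\<^sub>R mat 1 + snd (decode \<phi>)) $ k $ j *\<^sub>R F k)
      = lam0 *\<^sub>R F j - (\<Sum>k\<in>UNIV. c j k *\<^sub>R F k)" for j and F :: "'m \<Rightarrow> 'v \<Rightarrow>\<^sub>L real"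
  proof -
    have "(lam0 *\<^sub>R mat 1 + snd (decode \<phi>)) $ k $ j *\<^sub>R F k
        = (if k = j then lam0 *\<^sub>R F k else 0) - c j k *\<^sub>R F k" for k
      by (auto simp: decode_def c_def mat_def scaleR_left_distrib scaleR_left_diff_distrib)
    then show ?thesis by (simp add: sum_subtractf)
  qed
  \<comment> \<open>Expansion at the base point: \<open>eigen\<close> cancels order zero, and
    \<open>phi\<close> collects the terms linear in the unknown. Both residuals agree, so they
    vanish together.\<close>
  have eq: "a (\<mu>0 + fst h) (u0 $ j + w j)
        - (\<Sum>k\<in>UNIV. (lam0 *\<^sub>R mat 1 + snd (decode \<phi>)) $ k $ j *\<^sub>R b (\<epsilon>0 + snd h) (u0 $ k + w k))
      = \<phi> $ j - (lam0 *\<^sub>R b (snd h) (u0 $ j) - a (fst h) (u0 $ j)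
        + (lam0 *\<^sub>R b (snd h) (w j) - a (fst h) (w j)
          - (\<Sum>k\<in>UNIV. c j k *\<^sub>R (b (snd h) (u0 $ k) + b \<epsilon>0 (w k) + s k))))" for j
    unfolding lam
    by (subst phi) (simp add: s_def blinfun.add_left blinfun.add_right eigen scaleR_right_distrib sum.distrib)
  have "(\<exists>s'. (h, \<phi>, s') = lin h + quad (h, \<phi>, s') (h, \<phi>, s')) \<longleftrightarrow>
      (h, \<phi>, (\<chi> k. s k)) = lin h + quad (h, \<phi>, (\<chi> k. s k)) (h, \<phi>, (\<chi> k. s k))"
    by (auto simp: lin_def quad_def s_def w_def)
  also have "\<dots> \<longleftrightarrow> (\<forall>j. \<phi> $ j = lam0 *\<^sub>R b (snd h) (u0 $ j) - a (fst h) (u0 $ j)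
        + (lam0 *\<^sub>R b (snd h) (w j) - a (fst h) (w j)
          - (\<Sum>k\<in>UNIV. c j k *\<^sub>R (b (snd h) (u0 $ k) + b \<epsilon>0 (w k) + s k))))"
    by (simp add: lin_def quad_def vec_eq_iff w_def c_def s_def)
  also have "\<dots> \<longleftrightarrow> solves (\<mu>0 + fst h) (\<epsilon>0 + snd h) ((u0, lam0 *\<^sub>R mat 1) + decode \<phi>)"
  proof -
    have "fst ((u0, lam0 *\<^sub>R mat 1) + decode \<phi>) $ j = u0 $ j + w j" for j
      by (simp add: decode_def w_def)
    then show ?thesis
      unfolding solves_def using diff_eq_diff_eq[OF eq] by simp
  qed
  finally show ?thesis by simp
qed

text \<open>The trajectory is the initial value plus the decoded middle component of the quadratic
  solution. Its increment is orthogonal at every \<open>p\<close>, because the vectors produced by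
  \<open>decode\<close> are values of \<open>rest\<close>.\<close>

lemma analytic_continuation:
  obtains f r where "0 < r" "f (\<mu>0, \<epsilon>0) = (u0, lam0 *\<^sub>R mat 1)"
    "\<And>p. p \<in> ball (\<mu>0, \<epsilon>0) r \<Longrightarrow> real_analytic_at f p"
    "\<And>p. p \<in> ball (\<mu>0, \<epsilon>0) r \<Longrightarrow> solves (fst p) (snd p) (f p)"
    "\<And>p j k. b \<epsilon>0 ((fst (f p) - u0) $ j) (u0 $ k) = 0"
    "\<And>W g. open W \<Longrightarrow> (\<mu>0, \<epsilon>0) \<in> W \<Longrightarrow> isCont g (\<mu>0, \<epsilon>0) \<Longrightarrow> g (\<mu>0, \<epsilon>0) = (u0, lam0 *\<^sub>R mat 1) \<Longrightarrow>
       (\<And>p. p \<in> W \<Longrightarrow> solves (fst p) (snd p) (g p)) \<Longrightarrow>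
       (\<And>p j k. p \<in> W \<Longrightarrow> b \<epsilon>0 ((fst (g p) - u0) $ j) (u0 $ k) = 0) \<Longrightarrow>
       \<forall>\<^sub>F p in nhds (\<mu>0, \<epsilon>0). g p = f p"
proof -
  interpret decode: bounded_linear decode by (rule bounded_linear_decode)
  define p0 where "p0 = (\<mu>0, \<epsilon>0)"
  define s0 :: "('v ^ 'm) \<times> (real ^ 'm ^ 'm)" where "s0 = (u0, lam0 *\<^sub>R mat 1)"
  obtain z r \<rho> where r: "0 < r" and \<rho>: "0 < \<rho>" and z0: "z 0 = 0"
    and z: "\<And>h. norm h < r \<Longrightarrow> z h = lin h + quad (z h) (z h)"
    and analytic: "\<And>h. norm h < r \<Longrightarrow> real_analytic_at z h"
    and unique: "\<And>h y. norm h < r \<Longrightarrow> norm y < \<rho> \<Longrightarrow> y = lin h + quad y y \<Longrightarrow> y = z h"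
  proof (rule quadratic_equation_analytic_solution[OF bounded_linear_lin bounded_bilinear_quad], goal_cases)
    case (1 z r \<rho>)
    from 1(2-) show thesis by (rule that)
  qed
  define f where "f p = s0 + decode (fst (snd (z (p - p0))))" for p
  have fst_z: "fst (z h) = h" if "norm h < r" for h
    by (subst z[OF that]) (simp add: lin_def quad_def)
  have ball: "norm (p - p0) < r" if "p \<in> ball p0 r" for p
    using that by (simp add: dist_norm norm_minus_commute)
  have 1: "real_analytic_at f p" if "p \<in> ball p0 r" for p
  proof (rule real_analytic_at_affine_compose)
    show "real_analytic_at z (p - p0)"
      by (rule analytic[OF ball[OF that]])
    show "bounded_linear (\<lambda>y. decode (fst (snd y)))"
      by (intro bounded_linear_compose[OF bounded_linear_decode] bounded_linear_compose[OF bounded_linear_fst]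
          bounded_linear_snd)
    show "\<forall>\<^sub>F h in nhds 0. f (p + h) = s0 + decode (fst (snd (z (p - p0 + h))))"
      by (simp add: f_def algebra_simps)
  qed
  have 2: "solves (fst p) (snd p) (f p)" if "p \<in> ball p0 r" for p
  proof -
    let ?h = "p - p0"
    have "z ?h = (?h, fst (snd (z ?h)), snd (snd (z ?h)))"
      using fst_z[OF ball[OF that]] by (metis prod.collapse)
    then have "(?h, fst (snd (z ?h)), snd (snd (z ?h)))
        = lin ?h + quad (?h, fst (snd (z ?h)), snd (snd (z ?h))) (?h, fst (snd (z ?h)), snd (snd (z ?h)))"
      using z[OF ball[OF that]] by simp
    then have "solves (\<mu>0 + fst ?h) (\<epsilon>0 + snd ?h) (s0 + decode (fst (snd (z ?h))))"
      unfolding s0_def solves_iff by blast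
    then show ?thesis by (simp add: f_def p0_def)
  qed
  have 3: "b \<epsilon>0 ((fst (f p) - u0) $ j) (u0 $ k) = 0" for p j k
    by (simp add: f_def s0_def decode_def rest_orthogonal)
  have 4: "\<forall>\<^sub>F p in nhds p0. g p = f p"
    if W: "open W" "p0 \<in> W" and g: "isCont g p0" "g p0 = s0"
      and solves: "\<And>p. p \<in> W \<Longrightarrow> solves (fst p) (snd p) (g p)"
      and orth: "\<And>p j k. p \<in> W \<Longrightarrow> b \<epsilon>0 ((fst (g p) - u0) $ j) (u0 $ k) = 0" for W g
  proof -
    \<comment> \<open>The state belonging to \<open>g\<close>, with the third component that the
      equation forces. All components vanish at \<open>p0\<close>, so continuity of \<open>g\<close>
      there puts \<open>y p\<close> inside the uniqueness ball for \<open>p\<close> near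
      \<open>p0\<close>.\<close>
    define y where "y p = (p - p0, encode (g p - s0), (\<chi> k. b (snd (p - p0)) (fst (g p - s0) $ k)))" for p
    have lim_p: "((\<lambda>p. p - p0) \<longlongrightarrow> 0) (nhds p0)"
      by (auto intro!: tendsto_eq_intros filterlim_ident)
    have "(g \<longlongrightarrow> s0) (nhds p0)"
      using isCont_tendsto_compose[OF g(1), of "\<lambda>p. p" "nhds p0"] g(2) by (simp add: filterlim_ident)
    then have lim_g: "((\<lambda>p. g p - s0) \<longlongrightarrow> 0) (nhds p0)"
      by (simp add: LIM_zero_iff)
    have "(y \<longlongrightarrow> (0, encode 0, \<chi> k. b (snd (0 :: 'x \<times> 'y)) (fst (0 :: ('v ^ 'm) \<times> (real ^ 'm ^ 'm)) $ k))) (nhds p0)"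
      unfolding y_def
      by (intro tendsto_Pair tendsto_vec_lambda lim_p bounded_linear.tendsto[OF bounded_linear_encode] lim_g
          blinfun.tendsto tendsto_const tendsto_fst tendsto_snd tendsto_vec_nth)
    moreover have "(0 :: 'x \<times> 'y, encode 0, \<chi> k. b (snd (0 :: 'x \<times> 'y)) (fst (0 :: ('v ^ 'm) \<times> (real ^ 'm ^ 'm)) $ k)) = 0"
      using linear_0[OF bounded_linear.linear[OF bounded_linear_encode]] by (simp add: zero_prod_def vec_eq_iff)
    ultimately have "(y \<longlongrightarrow> 0) (nhds p0)" by (simp only:)
    then have ev1: "\<forall>\<^sub>F p in nhds p0. norm (y p) < \<rho>"
      using order_tendstoD(2)[OF tendsto_norm, of y 0 "nhds p0" \<rho>] \<rho> by simp
    have ev2: "\<forall>\<^sub>F p in nhds p0. norm (p - p0) < r"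
      using order_tendstoD(2)[OF tendsto_norm[OF lim_p], of r] r by simp
    have ev3: "\<forall>\<^sub>F p in nhds p0. p \<in> W"
      using W by (rule eventually_nhds_in_open)
    show ?thesis
      using ev1 ev2 ev3
    proof eventually_elim
      case (elim p)
      have dec: "decode (encode (g p - s0)) = g p - s0"
        using orth[OF elim(3)] by (intro decode_encode) (simp add: s0_def)
      have "solves (\<mu>0 + fst (p - p0)) (\<epsilon>0 + snd (p - p0)) (s0 + decode (encode (g p - s0)))"
        using solves[OF elim(3)] by (simp add: dec p0_def)
      then obtain s where s: "(p - p0, encode (g p - s0), s)
          = lin (p - p0) + quad (p - p0, encode (g p - s0), s) (p - p0, encode (g p - s0), s)"
        unfolding s0_def solves_iff by blast
      then have "s = (\<chi> k. b (snd (p - p0)) (rest (encode (g p - s0) $ k)))"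
        by (simp add: lin_def quad_def)
      moreover have "rest (encode (g p - s0) $ k) = fst (g p - s0) $ k" for k
        using arg_cong[OF dec, of "\<lambda>d. fst d $ k"] by (simp add: decode_def)
      ultimately have "y p = (p - p0, encode (g p - s0), s)"
        by (simp add: y_def)
      then have "y p = z (p - p0)"
        using s by (intro unique elim) simp
      then have "fst (snd (z (p - p0))) = encode (g p - s0)"
        by (simp flip: \<open>y p = z (p - p0)\<close> add: y_def)
      then show ?case by (simp add: f_def dec)
    qed
  qed
  have f0: "f p0 = s0"
    by (simp add: f_def z0 decode.zero)
  from r f0 1 2 3 4 show thesis
    unfolding p0_def s0_def by (rule that)
qed

end

section \<open>Matrix form of the equation, and assembly of the result\<close>

lemma form_matrix_eigen_iff:
  fixes A B :: "'v::real_normed_vector bform" and u :: "'v ^ 'm::finite"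
  shows "(\<forall>v. form_matrix (\<lambda>x y. A x y) u v = form_matrix (\<lambda>x y. B x y) u v ** l) \<longleftrightarrow>
    (\<forall>j. A (u $ j) = (\<Sum>k\<in>UNIV. l $ k $ j *\<^sub>R B (u $ k)))"
proof
  assume *: "\<forall>v. form_matrix (\<lambda>x y. A x y) u v = form_matrix (\<lambda>x y. B x y) u v ** l"
  show "\<forall>j. A (u $ j) = (\<Sum>k\<in>UNIV. l $ k $ j *\<^sub>R B (u $ k))"
  proof (intro allI blinfun_eqI)
    fix j x
    \<comment> \<open>Row \<open>i\<close> of the identity involves only entry \<open>i\<close> of
      \<open>v\<close>, so a vector with all entries \<open>x\<close> tests the functionals at
      \<open>x\<close>; any row would do.\<close>
    have "form_matrix (\<lambda>x y. A x y) u (\<chi> i. x) $ j $ j = (form_matrix (\<lambda>x y. B x y) u (\<chi> i. x) ** l) $ j $ j"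
      using * by metis
    then show "A (u $ j) x = (\<Sum>k\<in>UNIV. l $ k $ j *\<^sub>R B (u $ k)) x"
      by (simp add: form_matrix_def matrix_matrix_mult_def blinfun.sum_left blinfun.scaleR_left mult.commute)
  qed
next
  assume "\<forall>j. A (u $ j) = (\<Sum>k\<in>UNIV. l $ k $ j *\<^sub>R B (u $ k))"
  then show "\<forall>v. form_matrix (\<lambda>x y. A x y) u v = form_matrix (\<lambda>x y. B x y) u v ** l"
    by (simp add: form_matrix_def matrix_matrix_mult_def vec_eq_iff blinfun.sum_left blinfun.scaleR_left mult.commute)
qed

theorem theorem2p4:
  fixes \<iota> :: "'v::{real_inner,complete_space} \<Rightarrow> 'h::{real_inner,complete_space}"
    and a :: "'x::banach \<Rightarrow>\<^sub>L 'v bform"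
    and b :: "'y::banach \<Rightarrow>\<^sub>L 'h bform"
    and \<mu>0 :: 'x and \<epsilon>0 :: 'y
    and lam0 :: real
    and U0 :: "'v set"
    and u0 :: "'v ^ 'm::finite"
  defines "a0 \<equiv> \<lambda>u v. blinfun_apply (blinfun_apply (blinfun_apply a \<mu>0) u) v"
    and "b0 \<equiv> restrict_form \<iota> (blinfun_apply b \<epsilon>0)"
  assumes embedding: "dense_compact_embedding \<iota>"
    and forms: "\<forall>\<^sub>F (\<mu>, \<epsilon>) in nhds (\<mu>0, \<epsilon>0).
        symmetric_form (blinfun_apply a \<mu>) \<and> elliptic_form (blinfun_apply a \<mu>) \<and>
        symmetric_form (blinfun_apply b \<epsilon>) \<and> elliptic_form (blinfun_apply b \<epsilon>)"
    and eigenvalue: "is_eigenvalue_of_mult CARD('m) a0 b0 lam0"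
    and eigenspace: "U0 = eigenspace a0 b0 lam0"
    and basis: "orthonormal_basis_of b0 U0 u0"
  shows "\<exists>W f.
      analytic_trajectory \<iota> a b (\<mu>0, \<epsilon>0) (u0, lam0 *\<^sub>R mat 1) W f \<and>
      increment_in (orth_compl b0 U0) u0 W f \<and>
      (\<forall>W' g.
         analytic_trajectory \<iota> a b (\<mu>0, \<epsilon>0) (u0, lam0 *\<^sub>R mat 1) W' g \<and>
         increment_in (orth_compl b0 U0) u0 W' g \<longrightarrow>
         (\<forall>\<^sub>F p in nhds (\<mu>0, \<epsilon>0). g p = f p))"
proof -
  obtain b' :: "'y \<Rightarrow>\<^sub>L 'v bform" where b': "\<And>\<epsilon> u v. b' \<epsilon> u v = restrict_form \<iota> (b \<epsilon>) u v"
    using pullback_forms[of \<iota> b] embedding unfolding dense_compact_embedding_def by blast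
  have forms0: "symmetric_form (a \<mu>0)" "elliptic_form (a \<mu>0)" "symmetric_form (b \<epsilon>0)"
    using eventually_nhds_x_imp_x[OF forms] by auto
  have b0: "b0 = (\<lambda>u v. b' \<epsilon>0 u v)"
    by (simp add: b0_def b' fun_eq_iff)
  have U0: "U0 = {u. a \<mu>0 u = lam0 *\<^sub>R b' \<epsilon>0 u}"
    by (auto simp: eigenspace eigenspace_def a0_def b0 blinfun.scaleR_left intro: blinfun_eqI)
  have u0: "orthonormal_basis_of (b' \<epsilon>0) {u. a \<mu>0 u = lam0 *\<^sub>R b' \<epsilon>0 u} u0"
    using basis by (simp add: b0 U0)
  obtain N :: "('v \<Rightarrow>\<^sub>L real) \<Rightarrow>\<^sub>L 'v"
    where N: "\<And>f. a \<mu>0 (N f) - lam0 *\<^sub>R b' \<epsilon>0 (N f) + (\<Sum>k\<in>UNIV. b' \<epsilon>0 (N f) (u0 $ k) *\<^sub>R b' \<epsilon>0 (u0 $ k)) = f"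
      "\<And>w. N (a \<mu>0 w - lam0 *\<^sub>R b' \<epsilon>0 w + (\<Sum>k\<in>UNIV. b' \<epsilon>0 w (u0 $ k) *\<^sub>R b' \<epsilon>0 (u0 $ k))) = w"
    using eigenspace_isomorphism[OF embedding forms0 b' u0] by blast
  have u0_span: "span (range (\<lambda>i. u0 $ i)) = U0"
    using basis by (simp add: orthonormal_basis_of_def)
  have u0_mem: "u0 $ i \<in> U0" for i
    using u0_span span_base[OF rangeI, of "\<lambda>i. u0 $ i" i] by simp
  interpret eigenbasis_continuation a b' \<mu>0 \<epsilon>0 lam0 u0 N
  proof
    show "b' \<epsilon>0 (u0 $ i) (u0 $ j) = (if i = j then 1 else 0)" for i j
      using basis by (simp add: orthonormal_basis_of_def b0)
    show "a \<mu>0 (u0 $ j) = lam0 *\<^sub>R b' \<epsilon>0 (u0 $ j)" for j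
      using u0_mem[of j] by (simp add: U0)
  qed (rule N)+
  \<comment> \<open>As the eigenbasis spans \<open>U0\<close>, the increment condition takes the
    finite form used in the continuation.\<close>
  have orth: "w \<in> orth_compl b0 U0 \<longleftrightarrow> (\<forall>k. b' \<epsilon>0 w (u0 $ k) = 0)" for w
  proof
    assume "w \<in> orth_compl b0 U0"
    then show "\<forall>k. b' \<epsilon>0 w (u0 $ k) = 0"
      using u0_mem by (simp add: orth_compl_def b0)
  next
    assume *: "\<forall>k. b' \<epsilon>0 w (u0 $ k) = 0"
    have "b' \<epsilon>0 w u = 0" if "u \<in> span (range (\<lambda>i. u0 $ i))" for u
      using that by (induction rule: span_induct_alt) (auto simp: * blinfun.add_right blinfun.scaleR_right)
    then show "w \<in> orth_compl b0 U0"
      by (simp add: orth_compl_def b0 u0_span)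
  qed
  have trajectory: "analytic_trajectory \<iota> a b (\<mu>0, \<epsilon>0) s0 W f \<longleftrightarrow>
      open W \<and> (\<mu>0, \<epsilon>0) \<in> W \<and> real_analytic_on f W \<and> f (\<mu>0, \<epsilon>0) = s0 \<and>
      (\<forall>p\<in>W. solves (fst p) (snd p) (f p))" for s0 W f
  proof -
    have "restrict_form \<iota> (b \<epsilon>) = (\<lambda>x y. b' \<epsilon> x y)" for \<epsilon>
      by (simp add: b' fun_eq_iff)
    then have "(\<forall>v. form_matrix (\<lambda>x. blinfun_apply (a \<mu> x)) u v = form_matrix (restrict_form \<iota> (b \<epsilon>)) u v ** l)
        \<longleftrightarrow> solves \<mu> \<epsilon> (u, l)" for \<mu> \<epsilon> u l
      using form_matrix_eigen_iff[of "a \<mu>" u "b' \<epsilon>" l] by (simp add: solves_def)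
    moreover have "(\<forall>\<mu> \<epsilon> u l. (\<mu>, \<epsilon>) \<in> W \<longrightarrow> f (\<mu>, \<epsilon>) = (u, l) \<longrightarrow> solves \<mu> \<epsilon> (u, l))
        \<longleftrightarrow> (\<forall>p\<in>W. solves (fst p) (snd p) (f p))"
    proof (intro iffI ballI allI impI)
      fix p
      assume "\<forall>\<mu> \<epsilon> u l. (\<mu>, \<epsilon>) \<in> W \<longrightarrow> f (\<mu>, \<epsilon>) = (u, l) \<longrightarrow> solves \<mu> \<epsilon> (u, l)" "p \<in> W"
      from this(1)[rule_format, of "fst p" "snd p" "fst (f p)" "snd (f p)"] this(2)
      show "solves (fst p) (snd p) (f p)" by simp
    next
      fix \<mu> \<epsilon> u l
      assume "\<forall>p\<in>W. solves (fst p) (snd p) (f p)" "(\<mu>, \<epsilon>) \<in> W" "f (\<mu>, \<epsilon>) = (u, l)"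
      from bspec[OF this(1,2)] this(3) show "solves \<mu> \<epsilon> (u, l)" by simp
    qed
    ultimately show ?thesis
      unfolding analytic_trajectory_def by (simp only:)
  qed
  obtain f r where f: "0 < r" "f (\<mu>0, \<epsilon>0) = (u0, lam0 *\<^sub>R mat 1)"
    "\<And>p. p \<in> ball (\<mu>0, \<epsilon>0) r \<Longrightarrow> real_analytic_at f p"
    "\<And>p. p \<in> ball (\<mu>0, \<epsilon>0) r \<Longrightarrow> solves (fst p) (snd p) (f p)"
    "\<And>p j k. b' \<epsilon>0 ((fst (f p) - u0) $ j) (u0 $ k) = 0"
    "\<And>W g. open W \<Longrightarrow> (\<mu>0, \<epsilon>0) \<in> W \<Longrightarrow> isCont g (\<mu>0, \<epsilon>0) \<Longrightarrow> g (\<mu>0, \<epsilon>0) = (u0, lam0 *\<^sub>R mat 1) \<Longrightarrow>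
       (\<And>p. p \<in> W \<Longrightarrow> solves (fst p) (snd p) (g p)) \<Longrightarrow>
       (\<And>p j k. p \<in> W \<Longrightarrow> b' \<epsilon>0 ((fst (g p) - u0) $ j) (u0 $ k) = 0) \<Longrightarrow>
       \<forall>\<^sub>F p in nhds (\<mu>0, \<epsilon>0). g p = f p"
  proof (rule analytic_continuation, goal_cases)
    case (1 f r)
    from 1(2-) show thesis by (rule that)
  qed
  show ?thesis
  proof (intro exI conjI allI impI)
    show "analytic_trajectory \<iota> a b (\<mu>0, \<epsilon>0) (u0, lam0 *\<^sub>R mat 1) (ball (\<mu>0, \<epsilon>0) r) f"
      unfolding trajectory using f(1-4) by (simp add: real_analytic_on_def)
    show "increment_in (orth_compl b0 U0) u0 (ball (\<mu>0, \<epsilon>0) r) f"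
      using f(5) by (simp add: increment_in_def orth)
    fix W' g
    assume *: "analytic_trajectory \<iota> a b (\<mu>0, \<epsilon>0) (u0, lam0 *\<^sub>R mat 1) W' g \<and>
      increment_in (orth_compl b0 U0) u0 W' g"
    show "\<forall>\<^sub>F p in nhds (\<mu>0, \<epsilon>0). g p = f p"
    \<comment> \<open>Analyticity of \<open>g\<close> enters as continuity at the base
      point.\<close>
    proof (rule f(6)[of W'])
      show "isCont g (\<mu>0, \<epsilon>0)"
        using * unfolding trajectory real_analytic_on_def by (blast intro: real_analytic_at_isCont)
    qed (use * in \<open>auto simp: trajectory increment_in_def orth\<close>)
  qed
qed

end
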